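(* If $2^{\aleph_0}\leq \aleph_2$, then there is a universally meager set in $2^{\mathbb N}$ which is not countably perfectly meager in $2^{\mathbb N}$.
   Context: A perfect Polish space is a Polish space without isolated points; a perfect subset of a space is a closed subset without isolated points. $2^{\mathbb N}$ is the Cantor space with the usual product topology. Let $X$ be a perfect Polish space. A set $A\subseteq X$ is universally meager if for every Borel isomorphism $f$ between $X$ and any perfect Polish space $Y$, the image $f(A)$ is meager in $Y$. A set $A\subseteq X$ is countably perfectly meager in $X$ if for every sequence $\{P_n: n\in\mathbb N\}$ of perfect subsets of $X$ there exists an $F_\sigma$-set $F$ in $X$ such that $A\subseteq F$ and $F\cap P_n$ is meager in $P_n$ for each $n$. *)

theory Defs
  imports "HOL-Analysis.Analysis"
begin

unbundle cardinal_syntax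

abbreviation aleph_2 :: "nat set set rel" where
  "aleph_2 \<equiv> cardSuc (cardSuc natLeq)"

definition perfect_in :: "'a topology \<Rightarrow> 'a set \<Rightarrow> bool" where
  "perfect_in X P \<longleftrightarrow> closedin X P \<and> P \<subseteq> X derived_set_of P"

definition perfect_polish_space :: "'a topology \<Rightarrow> bool" where
  "perfect_polish_space X \<longleftrightarrow>
     completely_metrizable_space X \<and> separable_space X \<and> perfect_in X (topspace X)"

definition cantor_space :: "(nat \<Rightarrow> bool) topology" where
  "cantor_space = product_topology (\<lambda>_. discrete_topology UNIV) UNIV"

definition nowhere_dense_in :: "'a topology \<Rightarrow> 'a set \<Rightarrow> bool" where
  "nowhere_dense_in X S \<longleftrightarrow> S \<subseteq> topspace X \<and> X interior_of (X closure_of S) = {}"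

text \<open>Subsets of nowhere dense sets are nowhere dense, so being covered by countably many
  nowhere dense sets is the same as being a countable union of such sets.\<close>

definition meager_in :: "'a topology \<Rightarrow> 'a set \<Rightarrow> bool" where
  "meager_in X \<equiv> countable union_of nowhere_dense_in X"

definition borel_of :: "'a topology \<Rightarrow> 'a measure" where
  "borel_of X = sigma (topspace X) {U. openin X U}"

definition borel_isomorphism :: "'a topology \<Rightarrow> 'b topology \<Rightarrow> ('a \<Rightarrow> 'b) \<Rightarrow> bool" where
  "borel_isomorphism X Y f \<longleftrightarrow>
     bij_betw f (topspace X) (topspace Y) \<and>
     f \<in> borel_of X \<rightarrow>\<^sub>M borel_of Y \<and>
     the_inv_into (topspace X) f \<in> borel_of Y \<rightarrow>\<^sub>M borel_of X"

text \<open>The space \<open>Y\<close> below ranges over topologies on the element type of \<open>X\<close>, with arbitrary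
  carrier. This loses no generality, since a space Borel isomorphic to \<open>X\<close> is in bijection with
  \<open>topspace X\<close>: see \<open>universally_meagerD\<close> below, where the type of points of \<open>Y\<close> is arbitrary.
  Both this notion and the next one are meant for a perfect Polish space \<open>X\<close>.\<close>

definition universally_meager :: "'a topology \<Rightarrow> 'a set \<Rightarrow> bool" where
  "universally_meager X A \<longleftrightarrow>
     A \<subseteq> topspace X \<and>
     (\<forall>(Y :: 'a topology) f.
        perfect_polish_space Y \<and> borel_isomorphism X Y f \<longrightarrow> meager_in Y (f ` A))"

definition countably_perfectly_meager :: "'a topology \<Rightarrow> 'a set \<Rightarrow> bool" where
  "countably_perfectly_meager X A \<longleftrightarrow>
     A \<subseteq> topspace X \<and>
     (\<forall>P :: nat \<Rightarrow> 'a set. (\<forall>n. perfect_in X (P n)) \<longrightarrow>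
        (\<exists>F. fsigma_in X F \<and> A \<subseteq> F \<and>
             (\<forall>n. meager_in (subtopology X (P n)) (F \<inter> P n))))"

lemma topspace_cantor_space [simp]: "topspace cantor_space = UNIV"
  by (simp add: cantor_space_def)

lemma cantor_space_nbhd:
  assumes "openin cantor_space U" "x \<in> U"
  obtains k where "\<And>y. (\<And>n. n < k \<Longrightarrow> y n = x n) \<Longrightarrow> y \<in> U"
proof -
  obtain V where V: "finite {i. V i \<noteq> (UNIV::bool set)}" "x \<in> Pi\<^sub>E UNIV V" "Pi\<^sub>E UNIV V \<subseteq> U"
    using assms unfolding cantor_space_def openin_product_topology_alt by auto
  obtain k where k: "\<And>i. V i \<noteq> UNIV \<Longrightarrow> i < k"
    using V(1) unfolding finite_nat_set_iff_bounded by auto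
  have "y \<in> U" if "\<And>n. n < k \<Longrightarrow> y n = x n" for y
  proof -
    have "y i \<in> V i" for i
      using that[of i] k[of i] V(2) by (cases "i < k") (auto simp: PiE_iff)
    then show ?thesis using V(3) by (auto simp: PiE_iff)
  qed
  then show ?thesis using that by blast
qed

lemma perfect_polish_cantor_space: "perfect_polish_space cantor_space"
proof -
  have "completely_metrizable_space cantor_space"
    by (auto simp: cantor_space_def completely_metrizable_space_product_topology
        completely_metrizable_space_discrete_topology)
  moreover have "separable_space cantor_space"
  proof -
    let ?D = "(\<lambda>A n. n \<in> A) ` {A :: nat set. finite A}"
    have "countable ?D"
      by (intro countable_image countable_Collect_finite)
    moreover have "x \<in> cantor_space closure_of ?D" for x
      unfolding in_closure_of
    proof (intro conjI allI impI)
      fix T assume "x \<in> T \<and> openin cantor_space T"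
      then obtain k where k: "\<And>y. (\<And>n. n < k \<Longrightarrow> y n = x n) \<Longrightarrow> y \<in> T"
        using cantor_space_nbhd by metis
      have "(\<lambda>n. n \<in> {n. n < k \<and> x n}) \<in> ?D" by (rule imageI) simp
      moreover have "(\<lambda>n. n \<in> {n. n < k \<and> x n}) \<in> T" by (rule k) simp
      ultimately show "\<exists>y. y \<in> ?D \<and> y \<in> T" by blast
    qed simp
    ultimately show ?thesis
      unfolding separable_space_def topspace_cantor_space by blast
  qed
  moreover have "x \<in> cantor_space derived_set_of UNIV" for x
    unfolding in_derived_set_of
  proof (intro conjI allI impI)
    fix T assume "x \<in> T \<and> openin cantor_space T"
    then obtain k where k: "\<And>y. (\<And>n. n < k \<Longrightarrow> y n = x n) \<Longrightarrow> y \<in> T"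
      using cantor_space_nbhd by metis
    show "\<exists>y. y \<noteq> x \<and> y \<in> UNIV \<and> y \<in> T"
      by (rule exI[of _ "x(k := \<not> x k)"]) (auto intro!: k simp: fun_eq_iff)
  qed simp
  moreover have "closedin cantor_space UNIV"
    by (metis closedin_topspace topspace_cantor_space)
  ultimately show ?thesis
    unfolding perfect_polish_space_def perfect_in_def topspace_cantor_space by blast
qed

lemma space_borel_of: "space (borel_of X) = topspace X"
  by (simp add: borel_of_def space_measure_of_conv)

lemma homeomorphic_map_meager_in:
  assumes h: "homeomorphic_map X Y f" and A: "meager_in X A"
  shows "meager_in Y (f ` A)"
proof -
  have nd: "nowhere_dense_in Y (f ` S)" if "nowhere_dense_in X S" for S
  proof -
    have S: "S \<subseteq> topspace X" and "X interior_of (X closure_of S) = {}"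
      using that by (auto simp: nowhere_dense_in_def)
    then show ?thesis
      using homeomorphic_map_closure_of[OF h S]
        homeomorphic_map_interior_of[OF h closure_of_subset_topspace]
        image_mono[OF S, of f] homeomorphic_imp_surjective_map[OF h]
      by (simp add: nowhere_dense_in_def)
  qed
  obtain \<U> where U: "countable \<U>" "\<U> \<subseteq> Collect (nowhere_dense_in X)" "\<Union>\<U> = A"
    using A unfolding meager_in_def union_of_def by auto
  show ?thesis
    unfolding meager_in_def union_of_def
    using U nd by (intro exI[of _ "(`) f ` \<U>"]) auto
qed

lemma universally_meagerD:
  fixes X :: "'a topology" and Y :: "'b topology"
  assumes A: "universally_meager X A" and Y: "perfect_polish_space Y"
    and f: "borel_isomorphism X Y f"
  shows "meager_in Y (f ` A)"
proof -
  define Z where "Z = pullback_topology (topspace X) f Y"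
  let ?g = "the_inv_into (topspace X) f"
  have bij: "bij_betw f (topspace X) (topspace Y)"
    and fm: "f \<in> borel_of X \<rightarrow>\<^sub>M borel_of Y" and gm: "?g \<in> borel_of Y \<rightarrow>\<^sub>M borel_of X"
    using f by (auto simp: borel_isomorphism_def)
  have opZ: "openin Z S \<longleftrightarrow> (\<exists>U. openin Y U \<and> S = f -` U \<inter> topspace X)" for S
    by (simp add: Z_def openin_pullback_topology)
  have topZ: "topspace Z = topspace X"
    using bij by (auto simp: Z_def topspace_pullback_topology bij_betw_def)
  have inj: "inj_on f (topspace X)" and im: "f ` topspace X = topspace Y"
    using bij by (auto simp: bij_betw_def)
  have "homeomorphic_map Z Y f"
  proof (rule bijective_open_imp_homeomorphic_map)
    show "continuous_map Z Y f"
      using im by (auto simp: continuous_map_def topZ opZ)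
    show "open_map Z Y f"
      unfolding open_map_def
    proof (intro allI impI)
      fix S assume "openin Z S"
      then obtain U where U: "openin Y U" "S = f -` U \<inter> topspace X" by (auto simp: opZ)
      have "U \<subseteq> f ` topspace X" using openin_subset[OF U(1)] im by simp
      then have "f ` S = U" unfolding U(2) by blast
      then show "openin Y (f ` S)" using U by simp
    qed
  qed (use inj im topZ in auto)
  note h = this
  have hs: "Z homeomorphic_space Y" using h by (rule homeomorphic_map_imp_homeomorphic_space)
  have pZ: "perfect_polish_space Z"
  proof -
    have "Y derived_set_of (topspace Y) = f ` (Z derived_set_of (topspace Z))"
      using homeomorphic_map_derived_set_of[OF h, of "topspace Z"] im topZ by simp
    moreover have "Z derived_set_of (topspace Z) \<subseteq> topspace X"
      using derived_set_of_subset_topspace[of Z] topZ by metis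
    moreover have "topspace Y \<subseteq> Y derived_set_of (topspace Y)"
      using Y by (simp add: perfect_polish_space_def perfect_in_def)
    ultimately have "topspace Z \<subseteq> Z derived_set_of (topspace Z)"
      unfolding topZ using inj im by (metis inj_on_image_subset_iff order_refl)
    then show ?thesis
      using Y homeomorphic_completely_metrizable_space[OF hs] homeomorphic_separable_space[OF hs]
      by (auto simp: perfect_polish_space_def perfect_in_def)
  qed
  have m1: "(\<lambda>x. x) \<in> borel_of X \<rightarrow>\<^sub>M borel_of Z"
    unfolding borel_of_def[of Z]
  proof (rule measurable_measure_of)
    fix S assume "S \<in> {U. openin Z U}"
    then obtain U where U: "openin Y U" "S = f -` U \<inter> topspace X" by (auto simp: opZ)
    then have "U \<in> sets (borel_of Y)" unfolding borel_of_def
      by (subst sets_measure_of) (auto dest: openin_subset)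
    then have "f -` U \<inter> space (borel_of X) \<in> sets (borel_of X)"
      using fm by (rule measurable_sets[rotated])
    then show "(\<lambda>x. x) -` S \<inter> space (borel_of X) \<in> sets (borel_of X)"
      using U by (simp add: space_borel_of Int_assoc)
  next
    show "{U. openin Z U} \<subseteq> Pow (topspace Z)" using openin_subset[of Z] by auto
  qed (simp add: space_borel_of topZ)
  have "f \<in> borel_of Z \<rightarrow>\<^sub>M borel_of Y"
    unfolding borel_of_def[of Y]
  proof (rule measurable_measure_of)
    fix U assume "U \<in> {U. openin Y U}"
    then have "openin Z (f -` U \<inter> topspace X)" by (auto simp: opZ)
    then show "f -` U \<inter> space (borel_of Z) \<in> sets (borel_of Z)"
      unfolding space_borel_of topZ unfolding borel_of_def
      by (subst sets_measure_of) (auto dest: openin_subset)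
  next
    show "{U. openin Y U} \<subseteq> Pow (topspace Y)" using openin_subset[of Y] by auto
    show "f \<in> space (borel_of Z) \<rightarrow> topspace Y" using im by (auto simp: space_borel_of topZ)
  qed
  from measurable_comp[OF this gm] have "?g \<circ> f \<in> borel_of Z \<rightarrow>\<^sub>M borel_of X" .
  then have m2: "the_inv_into (topspace X) (\<lambda>x. x) \<in> borel_of Z \<rightarrow>\<^sub>M borel_of X"
    by (rule measurable_cong[THEN iffD1, rotated])
       (auto simp: borel_of_def space_measure_of_conv topZ the_inv_into_f_f[OF inj]
         the_inv_into_f_f[of "\<lambda>x. x"])
  have "borel_isomorphism X Z (\<lambda>x. x)"
    using m1 m2 by (simp add: borel_isomorphism_def topZ bij_betw_def)
  then have "meager_in Z ((\<lambda>x. x) ` A)"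
    using A pZ unfolding universally_meager_def by blast
  then show ?thesis using homeomorphic_map_meager_in[OF h] by simp
qed

end

theory Submission
  imports Defs "HOL-Library.Countable_Set_Type"
begin

text \<open>Split \<open>2\<^sup>\<nat>\<close> as a product of points \<open>(x, S)\<close> with \<open>S \<subseteq> \<nat>\<close>, and test countable perfect
  meagerness on the countably many fibres \<open>S = d\<close> with \<open>d\<close> finite. If an \<open>F\<^sub>\<sigma>\<close> set \<open>F\<close> is meager on
  each of them, then for comeager many \<open>x\<close> no \<open>(x, d)\<close> with \<open>d\<close> finite lies in \<open>F\<close>, and for such
  \<open>x\<close> we have \<open>(x, S) \<notin> F\<close> as soon as \<open>S\<close> has infinitely many sufficiently long gaps.

  Suppose first that all sets of size less than the continuum are meager. Enumerate \<open>2\<^sup>\<nat>\<close> as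
  \<open>y\<^sub>\<xi>\<close> and the \<open>F\<^sub>\<sigma>\<close> sets as \<open>F\<^sub>\<xi>\<close> in the order type of the continuum. A meager set is contained in one
  coded by some \<open>(x, S)\<close>; here \<open>x\<close> can be taken from a comeager set and \<open>S\<close> can be thinned out, so
  there is a code \<open>z\<^sub>\<xi> \<notin> F\<^sub>\<xi>\<close> of a meager set containing all \<open>y\<^sub>\<eta>\<close> with \<open>\<eta> \<le> \<xi>\<close>. The set of
  all \<open>z\<^sub>\<xi>\<close> is universally meager by Grzegorek's Fubini argument.

  Otherwise the continuum is at most \<open>\<aleph>\<^sub>2\<close> and some nonmeager set \<open>y\<^sub>\<alpha>\<close>, \<open>\<alpha> < \<omega>\<^sub>1\<close>, exists.
  Choose an infinite \<open>S\<^sub>\<alpha>\<close> so sparse that all its late intervals meet every infinite \<open>y\<^sub>\<beta>\<close>,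
  \<open>\<beta> \<le> \<alpha>\<close>. Then the set of all \<open>(y\<^sub>\<beta>, S\<^sub>\<alpha>)\<close> with \<open>\<beta> \<le> \<alpha>\<close> is as required: a given \<open>F\<close> is
  avoided by choosing first \<open>\<beta>\<close> and then \<open>\<alpha>\<close> large.\<close>

subsection \<open>Meager sets\<close>

lemma nowhere_dense_in_iff:
  "nowhere_dense_in X S \<longleftrightarrow> S \<subseteq> topspace X \<and>
    (\<forall>V. openin X V \<and> V \<noteq> {} \<longrightarrow> (\<exists>W. openin X W \<and> W \<noteq> {} \<and> W \<subseteq> V \<and> W \<inter> S = {}))"
proof (cases "S \<subseteq> topspace X")
  case True
  have "(X interior_of (X closure_of S) = {}) \<longleftrightarrow>
    (\<forall>V. openin X V \<and> V \<noteq> {} \<longrightarrow> (\<exists>W. openin X W \<and> W \<noteq> {} \<and> W \<subseteq> V \<and> W \<inter> S = {}))"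
  proof
    assume int: "X interior_of (X closure_of S) = {}"
    show "\<forall>V. openin X V \<and> V \<noteq> {} \<longrightarrow> (\<exists>W. openin X W \<and> W \<noteq> {} \<and> W \<subseteq> V \<and> W \<inter> S = {})"
    proof (intro allI impI)
      fix V assume V: "openin X V \<and> V \<noteq> {}"
      have "\<not> V \<subseteq> X closure_of S" using V int by (metis interior_of_maximal subset_empty)
      moreover have "openin X (V - X closure_of S)" using V by (simp add: openin_diff)
      ultimately show "\<exists>W. openin X W \<and> W \<noteq> {} \<and> W \<subseteq> V \<and> W \<inter> S = {}"
        using closure_of_subset[OF True] by (intro exI[of _ "V - X closure_of S"]) auto
    qed
  next
    assume *: "\<forall>V. openin X V \<and> V \<noteq> {} \<longrightarrow> (\<exists>W. openin X W \<and> W \<noteq> {} \<and> W \<subseteq> V \<and> W \<inter> S = {})"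
    show "X interior_of (X closure_of S) = {}"
    proof (rule ccontr)
      assume "X interior_of (X closure_of S) \<noteq> {}"
      then obtain W where W: "openin X W" "W \<noteq> {}" "W \<subseteq> X interior_of (X closure_of S)" "W \<inter> S = {}"
        using * by (metis openin_interior_of)
      then have "W \<inter> X closure_of S = {}" by (simp add: openin_Int_closure_of_eq_empty)
      then show False using W interior_of_subset by fastforce
    qed
  qed
  then show ?thesis using True by (simp add: nowhere_dense_in_def)
qed (simp add: nowhere_dense_in_def)

lemma nowhere_dense_inE:
  assumes "nowhere_dense_in X S" "openin X V" "V \<noteq> {}"
  obtains W where "openin X W" "W \<noteq> {}" "W \<subseteq> V" "W \<inter> S = {}"
  using assms unfolding nowhere_dense_in_iff by meson

lemma nowhere_dense_in_subset:
  assumes "nowhere_dense_in X S" "T \<subseteq> S"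
  shows "nowhere_dense_in X T"
  unfolding nowhere_dense_in_iff
proof (intro conjI allI impI)
  fix V assume "openin X V \<and> V \<noteq> {}"
  then obtain W where "openin X W" "W \<noteq> {}" "W \<subseteq> V" "W \<inter> S = {}"
    using nowhere_dense_inE[OF assms(1)] by metis
  then show "\<exists>W. openin X W \<and> W \<noteq> {} \<and> W \<subseteq> V \<and> W \<inter> T = {}"
    using assms(2) by (intro exI[of _ W]) auto
qed (use assms in \<open>auto simp: nowhere_dense_in_def\<close>)

lemma nowhere_dense_in_Un:
  assumes "nowhere_dense_in X S" "nowhere_dense_in X T"
  shows "nowhere_dense_in X (S \<union> T)"
  unfolding nowhere_dense_in_iff
proof (intro conjI allI impI)
  fix V assume "openin X V \<and> V \<noteq> {}"
  then obtain W where W: "openin X W" "W \<noteq> {}" "W \<subseteq> V" "W \<inter> S = {}"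
    using nowhere_dense_inE[OF assms(1)] by metis
  then obtain W' where "openin X W'" "W' \<noteq> {}" "W' \<subseteq> W" "W' \<inter> T = {}"
    using nowhere_dense_inE[OF assms(2)] by metis
  then show "\<exists>W. openin X W \<and> W \<noteq> {} \<and> W \<subseteq> V \<and> W \<inter> (S \<union> T) = {}"
    using W by (intro exI[of _ W']) auto
qed (use assms in \<open>auto simp: nowhere_dense_in_def\<close>)

lemma nowhere_dense_in_empty: "nowhere_dense_in X {}"
  by (simp add: nowhere_dense_in_def)

lemma nowhere_dense_in_finite_UN:
  "finite I \<Longrightarrow> (\<And>i. i \<in> I \<Longrightarrow> nowhere_dense_in X (S i)) \<Longrightarrow> nowhere_dense_in X (\<Union>i\<in>I. S i)"
  by (induction I rule: finite_induct) (auto intro: nowhere_dense_in_empty nowhere_dense_in_Un)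

text \<open>An open \<open>V\<close> that misses \<open>U\<close> also misses its closure; otherwise
  \<open>V \<inter> U\<close> is open and lies off the frontier.\<close>

lemma nowhere_dense_in_frontier_of:
  assumes "openin X U" shows "nowhere_dense_in X (X frontier_of U)"
  unfolding nowhere_dense_in_iff
proof (intro conjI allI impI)
  fix V assume V: "openin X V \<and> V \<noteq> {}"
  show "\<exists>W. openin X W \<and> W \<noteq> {} \<and> W \<subseteq> V \<and> W \<inter> X frontier_of U = {}"
  proof (cases "V \<inter> U = {}")
    case True
    then have "V \<inter> X closure_of U = {}" using V by (simp add: openin_Int_closure_of_eq_empty)
    then show ?thesis using V by (intro exI[of _ V]) (auto simp: frontier_of_def)
  next
    case False
    then show ?thesis using V assms
      by (intro exI[of _ "V \<inter> U"]) (auto simp: frontier_of_openin)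
  qed
qed (rule frontier_of_subset_topspace)

lemma nowhere_dense_in_singleton:
  assumes "t1_space X" "topspace X \<subseteq> X derived_set_of topspace X" "x \<in> topspace X"
  shows "nowhere_dense_in X {x}"
  unfolding nowhere_dense_in_iff
proof (intro conjI allI impI)
  fix V assume V: "openin X V \<and> V \<noteq> {}"
  have "V - {x} \<noteq> {}"
  proof
    assume "V - {x} = {}"
    then have "V = {x}" using V by auto
    moreover obtain y where "y \<noteq> x" "y \<in> topspace X" "y \<in> V"
      using assms(2,3) V \<open>V = {x}\<close> by (auto simp: subset_iff in_derived_set_of)
    ultimately show False by auto
  qed
  then show "\<exists>W. openin X W \<and> W \<noteq> {} \<and> W \<subseteq> V \<and> W \<inter> {x} = {}"
    using V assms by (intro exI[of _ "V - {x}"]) (auto simp: t1_space_openin_delete_alt)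
qed (use assms in auto)

lemma meager_in_nowhere_dense: "nowhere_dense_in X S \<Longrightarrow> meager_in X S"
  unfolding meager_in_def by (rule countable_union_of_inc)

lemma meager_in_sequence:
  assumes "meager_in X S"
  obtains L where "\<And>i::nat. nowhere_dense_in X (L i)" "S = (\<Union>i. L i)"
proof -
  obtain \<U> where U: "countable \<U>" "\<U> \<subseteq> Collect (nowhere_dense_in X)" "\<Union>\<U> = S"
    using assms unfolding meager_in_def union_of_def by auto
  \<comment> \<open>Adding the empty set makes the family nonempty, so that
    \<open>from_nat_into\<close> enumerates exactly this family.\<close>
  have r: "range (from_nat_into (insert {} \<U>)) = insert {} \<U>"
    using U(1) by (simp add: range_from_nat_into)
  show ?thesis
  proof (rule that[of "from_nat_into (insert {} \<U>)"])
    show "nowhere_dense_in X (from_nat_into (insert {} \<U>) i)" for i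
      using U(2) from_nat_into[of "insert {} \<U>" i] nowhere_dense_in_empty by auto
    show "S = \<Union> (range (from_nat_into (insert {} \<U>)))"
      unfolding r using U(3) by simp
  qed
qed

lemma meager_in_subset:
  assumes "meager_in X S" "T \<subseteq> S" shows "meager_in X T"
proof -
  obtain L where L: "\<And>i::nat. nowhere_dense_in X (L i)" "S = (\<Union>i. L i)"
    using meager_in_sequence[OF assms(1)] by blast
  then have "T = \<Union>(range (\<lambda>i. L i \<inter> T))" using assms(2) by auto
  then show ?thesis
    unfolding meager_in_def union_of_def
    using L nowhere_dense_in_subset[OF L(1) Int_lower1]
    by (intro exI[of _ "range (\<lambda>i. L i \<inter> T)"]) auto
qed

lemma meager_in_UN:
  assumes "countable I" "\<And>i. i \<in> I \<Longrightarrow> meager_in X (S i)"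
  shows "meager_in X (\<Union>i\<in>I. S i)"
  using assms unfolding meager_in_def by (auto intro!: countable_union_of_Union)

lemma meager_in_Un: "meager_in X S \<Longrightarrow> meager_in X T \<Longrightarrow> meager_in X (S \<union> T)"
  unfolding meager_in_def by (rule countable_union_of_Un)

lemma meager_in_countable:
  assumes "t1_space X" "topspace X \<subseteq> X derived_set_of topspace X" "A \<subseteq> topspace X" "countable A"
  shows "meager_in X A"
proof -
  have "meager_in X (\<Union>a\<in>A. {a})"
    using assms by (intro meager_in_UN meager_in_nowhere_dense nowhere_dense_in_singleton) auto
  then show ?thesis by simp
qed

lemma not_meager_in_topspace:
  assumes "completely_metrizable_space X" "topspace X \<noteq> {}"
  shows "\<not> meager_in X (topspace X)"
proof
  assume "meager_in X (topspace X)"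
  then obtain L where L: "\<And>i::nat. nowhere_dense_in X (L i)" "topspace X = (\<Union>i. L i)"
    using meager_in_sequence by blast
  have "X interior_of \<Union>(range (\<lambda>i. X closure_of L i)) = {}"
    using assms L by (intro Baire_category_alt) (auto simp: nowhere_dense_in_def)
  moreover have "\<Union>(range (\<lambda>i. X closure_of L i)) = topspace X"
  proof -
    have "L i \<subseteq> X closure_of L i" for i
      using L(1) by (intro closure_of_subset) (simp add: nowhere_dense_in_def)
    then show ?thesis
      unfolding L(2) by (metis L(2) SUP_mono' UN_least closure_of_subset_topspace subset_antisym)
  qed
  ultimately show False using assms by simp
qed

lemma metrizable_separable_imp_second_countable:
  assumes "metrizable_space X" "separable_space X"
  shows "second_countable X"
proof -
  obtain M d where M: "Metric_space M d" "X = Metric_space.mtopology M d"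
    using assms by (auto simp: metrizable_space_def)
  interpret Metric_space M d by fact
  obtain C where C: "countable C" "C \<subseteq> M" "mtopology closure_of C = M"
    using assms M by (auto simp: separable_space_def)
  define \<B> where "\<B> = (\<lambda>(c, n::nat). mball c (inverse (Suc n))) ` (C \<times> UNIV)"
  have "\<exists>V\<in>\<B>. x \<in> V \<and> V \<subseteq> U" if U: "openin mtopology U" "x \<in> U" for U x
  proof -
    obtain r where r: "r > 0" "mball x r \<subseteq> U" using U by (auto simp: openin_mtopology)
    have xM: "x \<in> M" using U openin_subset by fastforce
    obtain n where n: "inverse (Suc n) < r / 2" using r reals_Archimedean[of "r/2"] by auto
    have "x \<in> mtopology closure_of C" using xM C by simp
    moreover have "0 < inverse (real (Suc n))" by simp
    ultimately obtain c where c: "c \<in> C" "c \<in> mball x (inverse (Suc n))"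
      unfolding metric_closure_of by blast
    have "mball c (inverse (Suc n)) \<subseteq> mball x r"
    proof
      fix y assume "y \<in> mball c (inverse (Suc n))"
      then show "y \<in> mball x r" using c n triangle[of x c y] by auto
    qed
    moreover have "x \<in> mball c (inverse (Suc n))" using c by (auto simp: commute)
    ultimately show ?thesis using c r unfolding \<B>_def by blast
  qed
  moreover have "countable \<B>" unfolding \<B>_def using C by blast
  moreover have "\<forall>V\<in>\<B>. openin mtopology V" unfolding \<B>_def by auto
  ultimately show ?thesis unfolding second_countable_def M(2) by blast
qed

lemma perfect_polish_space_facts:
  assumes "perfect_polish_space X"
  shows "completely_metrizable_space X" "second_countable X" "Hausdorff_space X" "t1_space X"
    "topspace X \<subseteq> X derived_set_of topspace X"
  using assms
  by (auto simp: perfect_polish_space_def perfect_in_def completely_metrizable_imp_metrizable_space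
      intro: metrizable_separable_imp_second_countable metrizable_imp_Hausdorff_space
        metrizable_imp_t1_space)

lemma second_countable_sequence:
  assumes "second_countable X"
  obtains V where "\<And>n::nat. openin X (V n)"
    "\<And>U x. openin X U \<Longrightarrow> x \<in> U \<Longrightarrow> \<exists>n. x \<in> V n \<and> V n \<subseteq> U"
proof -
  obtain \<B> where B: "countable \<B>" "\<forall>V \<in> \<B>. openin X V"
     "\<forall>U x. openin X U \<and> x \<in> U \<longrightarrow> (\<exists>V \<in> \<B>. x \<in> V \<and> V \<subseteq> U)"
    using assms unfolding second_countable_def by blast
  have r: "range (from_nat_into (insert {} \<B>)) = insert {} \<B>"
    using B by (simp add: range_from_nat_into)
  show ?thesis
  proof (rule that[of "from_nat_into (insert {} \<B>)"])
    show "openin X (from_nat_into (insert {} \<B>) n)" for n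
      using B(2) from_nat_into[of "insert {} \<B>" n] by auto
    show "\<exists>n. x \<in> from_nat_into (insert {} \<B>) n \<and> from_nat_into (insert {} \<B>) n \<subseteq> U"
      if "openin X U" "x \<in> U" for U x
      using that B(3) r by (metis (no_types, lifting) imageE insertCI)
  qed
qed

section \<open>The Baire property and the Kuratowski-Ulam theorem\<close>

text \<open>Induction on the generated sigma-algebra. For a complement, \<open>U\<close> is replaced
  by its exterior, and its nowhere dense frontier joins the exceptional set.\<close>

lemma borel_of_Baire_property:
  assumes "B \<in> sets (borel_of X)"
  shows "\<exists>U N. openin X U \<and> meager_in X N \<and> (\<forall>x \<in> topspace X - N. x \<in> B \<longleftrightarrow> x \<in> U)"
proof -
  have "B \<in> sigma_sets (topspace X) {U. openin X U}"
    using assms unfolding borel_of_def by (subst (asm) sets_measure_of) (auto dest: openin_subset)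
  then show ?thesis
  proof induction
    case (Basic a)
    then show ?case using meager_in_nowhere_dense[OF nowhere_dense_in_empty, of X] by blast
  next
    case Empty
    then show ?case using meager_in_nowhere_dense[OF nowhere_dense_in_empty, of X] openin_empty by blast
  next
    case (Compl a)
    then obtain U N where U: "openin X U" "meager_in X N" "\<forall>x \<in> topspace X - N. x \<in> a \<longleftrightarrow> x \<in> U"
      by blast
    have "meager_in X (N \<union> X frontier_of U)"
      by (rule meager_in_Un[OF U(2) meager_in_nowhere_dense[OF nowhere_dense_in_frontier_of[OF U(1)]]])
    moreover have "openin X (topspace X - X closure_of U)" by (simp add: openin_diff)
    moreover have "\<forall>x \<in> topspace X - (N \<union> X frontier_of U).
        x \<in> topspace X - a \<longleftrightarrow> x \<in> topspace X - X closure_of U"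
      using U(3) closure_of_subset[OF openin_subset[OF U(1)]]
      unfolding frontier_of_openin[OF U(1)] by blast
    ultimately show ?case by blast
  next
    case (Union a)
    then obtain U N where U: "\<And>i::nat. openin X (U i)" "\<And>i. meager_in X (N i)"
      "\<And>i. \<forall>x \<in> topspace X - N i. x \<in> a i \<longleftrightarrow> x \<in> U i"
      by metis
    have "meager_in X (\<Union>i. N i)" using U(2) by (intro meager_in_UN) auto
    moreover have "\<forall>x \<in> topspace X - (\<Union>i. N i). x \<in> (\<Union>i. a i) \<longleftrightarrow> x \<in> (\<Union>i. U i)"
      using U(3) by blast
    moreover have "openin X (\<Union>i. U i)" using U(1) by blast
    ultimately show ?case by blast
  qed
qed

text \<open>Kuratowski-Ulam phrased with countably many rectangles, so that no product space is
  formed. By \<open>dense\<close>, for each \<open>k\<close> the union of the \<open>U k j\<close>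
  with \<open>t \<in> B k j\<close> is open and dense in \<open>W\<close>; the conclusion concerns
  the sections in the other direction.\<close>

lemma Kuratowski_Ulam_rectangles:
  fixes B :: "'k::countable \<Rightarrow> 'j::countable \<Rightarrow> 'a set"
  assumes Y: "second_countable Y"
    and B: "\<And>k j. B k j \<in> sets (borel_of Y)"
    and U: "\<And>k j. openin W (U k j)"
    and T: "T \<subseteq> topspace Y"
    and dense: "\<And>t k G. t \<in> T \<Longrightarrow> openin W G \<Longrightarrow> G \<noteq> {} \<Longrightarrow> \<exists>j. t \<in> B k j \<and> U k j \<inter> G \<noteq> {}"
  obtains M where "meager_in W M"
    "\<And>w. w \<in> topspace W - M \<Longrightarrow> meager_in Y {t \<in> T. \<exists>k. \<forall>j. t \<in> B k j \<longrightarrow> w \<notin> U k j}"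
proof -
  obtain V where V: "\<And>n::nat. openin Y (V n)"
    "\<And>U x. openin Y U \<Longrightarrow> x \<in> U \<Longrightarrow> \<exists>n. x \<in> V n \<and> V n \<subseteq> U"
    using second_countable_sequence[OF Y] by blast
  obtain Q N where Q: "\<And>k j. openin Y (Q k j)" "\<And>k j. meager_in Y (N k j)"
      "\<And>k j x. x \<in> topspace Y - N k j \<Longrightarrow> x \<in> B k j \<longleftrightarrow> x \<in> Q k j"
    using borel_of_Baire_property[OF B] by metis
  \<comment> \<open>Off the meager set \<open>NN\<close> the Borel sets \<open>B k j\<close>
    coincide with the open sets \<open>Q k j\<close>.\<close>
  define NN where "NN = (\<Union>k. \<Union>j. N k j)"
  have NN: "meager_in Y NN" unfolding NN_def using Q by (intro meager_in_UN) auto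
  \<comment> \<open>\<open>S k n\<close> is the set of \<open>w\<close> for which the union of the
    \<open>Q k j\<close> with \<open>w \<in> U k j\<close> meets the basic set \<open>V n\<close>.
    The set \<open>M\<close> removes all \<open>w\<close> outside some dense
    \<open>S k n\<close>.\<close>
  define S where "S k n = (\<Union>j\<in>{j. Q k j \<inter> V n \<noteq> {}}. U k j)" for k n
  have opS: "openin W (S k n)" for k n unfolding S_def using U by blast
  define good where "good k n \<longleftrightarrow> nowhere_dense_in W (topspace W - S k n)" for k n
  define M where "M = (\<Union>(k, n)\<in>{(k,n). good k n}. topspace W - S k n)"
  have "meager_in W M"
    unfolding M_def by (intro meager_in_UN) (auto simp: good_def intro!: meager_in_nowhere_dense)
  moreover have "meager_in Y {t \<in> T. \<exists>k. \<forall>j. t \<in> B k j \<longrightarrow> w \<notin> U k j}" if w: "w \<in> topspace W - M" for w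
  proof -
    define O' where "O' k = (\<Union>j\<in>{j. w \<in> U k j}. Q k j)" for k
    have opO: "openin Y (O' k)" for k unfolding O'_def using Q by blast
    \<comment> \<open>If some \<open>t \<in> T \<inter> V n\<close> avoids \<open>NN\<close>, then
      its dense open section lies in \<open>S k n\<close>, and the pair is good.\<close>
    have bad: "T \<inter> V n \<subseteq> NN" if bad: "\<not> good k n" for k n
    proof
      fix t assume t: "t \<in> T \<inter> V n"
      obtain G where G: "openin W G" "G \<noteq> {}"
          "\<forall>G'. openin W G' \<and> G' \<noteq> {} \<and> G' \<subseteq> G \<longrightarrow> G' \<inter> (topspace W - S k n) \<noteq> {}"
        using bad unfolding good_def nowhere_dense_in_iff by blast
      obtain j where j: "t \<in> B k j" "U k j \<inter> G \<noteq> {}" using dense[of t G k] t G by auto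
      show "t \<in> NN"
      proof (rule ccontr)
        assume "t \<notin> NN"
        then have "t \<in> Q k j" using j Q(3)[of t k j] t T unfolding NN_def by blast
        then have "U k j \<subseteq> S k n" using t unfolding S_def by auto
        moreover have "openin W (U k j \<inter> G)" using U G by auto
        ultimately have "(U k j \<inter> G) \<inter> (topspace W - S k n) \<noteq> {}"
          using G(3)[rule_format, of "U k j \<inter> G"] j(2) by blast
        then show False using \<open>U k j \<subseteq> S k n\<close> by blast
      qed
    qed
    \<comment> \<open>An exceptional \<open>t\<close> outside \<open>NN\<close> is not in
      \<open>O' k\<close>. If it is not on the frontier either, a basic neighbourhood
      \<open>V n\<close> misses \<open>O' k\<close>, while \<open>w \<in> S k n\<close> says that
      they meet.\<close>
    have "{t \<in> T. \<exists>k. \<forall>j. t \<in> B k j \<longrightarrow> w \<notin> U k j} \<subseteq> NN \<union> (\<Union>k. Y frontier_of (O' k))"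
    proof (safe, rule ccontr)
      fix t k assume t: "t \<in> T" "\<forall>j. t \<in> B k j \<longrightarrow> w \<notin> U k j" "t \<notin> NN"
        and "t \<notin> (\<Union>k. Y frontier_of (O' k))"
      then have nf: "t \<notin> Y frontier_of (O' k)" by auto
      have "t \<notin> O' k" using t Q(3)[of t k] T unfolding O'_def NN_def by blast
      then have "t \<in> topspace Y - Y closure_of (O' k)"
        using nf t(1) T opO[of k] by (auto simp: frontier_of_openin)
      then obtain n where n: "t \<in> V n" "V n \<subseteq> topspace Y - Y closure_of (O' k)"
        using V(2)[of "topspace Y - Y closure_of (O' k)" t] by (auto simp: openin_diff)
      have "good k n" using bad[of k n] t n by blast
      then have "w \<in> S k n" using w unfolding M_def by auto
      then obtain j where "Q k j \<inter> V n \<noteq> {}" "w \<in> U k j" unfolding S_def by auto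
      then have "V n \<inter> O' k \<noteq> {}" unfolding O'_def by auto
      then show False using n(2) closure_of_subset[OF openin_subset[OF opO[of k]]] by auto
    qed
    moreover have "meager_in Y (NN \<union> (\<Union>k. Y frontier_of (O' k)))"
      using NN opO
      by (intro meager_in_Un[OF NN] meager_in_UN)
         (auto intro: meager_in_nowhere_dense nowhere_dense_in_frontier_of)
    ultimately show ?thesis by (rule meager_in_subset[rotated])
  qed
  ultimately show ?thesis using that by blast
qed

section \<open>Criteria for universal meagerness\<close>

lemma borel_isomorphism_image:
  assumes "borel_isomorphism X Y f" "B \<in> sets (borel_of X)"
  shows "f ` B \<in> sets (borel_of Y)"
proof -
  have bij: "bij_betw f (topspace X) (topspace Y)"
    and m: "the_inv_into (topspace X) f \<in> borel_of Y \<rightarrow>\<^sub>M borel_of X"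
    using assms by (auto simp: borel_isomorphism_def)
  have "B \<subseteq> topspace X" using sets.sets_into_space[OF assms(2)] by (simp add: space_borel_of)
  then have "f ` B = the_inv_into (topspace X) f -` B \<inter> space (borel_of Y)"
    using bij unfolding space_borel_of bij_betw_def
    by (auto simp: the_inv_into_f_f subset_iff f_the_inv_into_f intro!: image_eqI)
  then show ?thesis using measurable_sets[OF m assms(2)] by simp
qed

text \<open>Grzegorek's argument. Over \<open>E\<close>, the relation
  \<open>\<Union>k. - (\<Union>j. B k j \<times> U k j)\<close> has meager sections. Hence, in any space Borel isomorphic to the
  given one, its section at some \<open>w \<in> N\<close> is meager by Kuratowski--Ulam, and the rest of \<open>E\<close> is
  the set in the hypothesis \<open>small\<close>.\<close>

lemma universally_meager_Grzegorek:
  fixes B :: "'k::countable \<Rightarrow> 'j::countable \<Rightarrow> 'a set"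
  assumes E: "E \<subseteq> topspace X"
    and B: "\<And>k j. B k j \<in> sets (borel_of X)"
    and U: "\<And>k j. openin W (U k j)"
    and dense: "\<And>z k G. z \<in> E \<Longrightarrow> openin W G \<Longrightarrow> G \<noteq> {} \<Longrightarrow> \<exists>j. z \<in> B k j \<and> U k j \<inter> G \<noteq> {}"
    and N: "N \<subseteq> topspace W" "\<not> meager_in W N"
    and small: "\<And>w. w \<in> N \<Longrightarrow> universally_meager X {z \<in> E. \<forall>k. \<exists>j. z \<in> B k j \<and> w \<in> U k j}"
  shows "universally_meager X E"
  unfolding universally_meager_def
proof (intro conjI allI impI E)
  fix Y :: "'a topology" and f
  assume Yf: "perfect_polish_space Y \<and> borel_isomorphism X Y f"
  then have inj: "inj_on f (topspace X)" and im: "f ` topspace X = topspace Y"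
    by (auto simp: borel_isomorphism_def bij_betw_def)
  have BX: "B k j \<subseteq> topspace X" for k j
    using sets.sets_into_space[OF B] by (simp add: space_borel_of)
  have iff: "f z \<in> f ` B k j \<longleftrightarrow> z \<in> B k j" if "z \<in> E" for z k j
    using inj_on_image_mem_iff[OF inj, of z "B k j"] that E BX by auto
  obtain M where M: "meager_in W M"
    "\<And>w. w \<in> topspace W - M \<Longrightarrow> meager_in Y {t \<in> f ` E. \<exists>k. \<forall>j. t \<in> f ` B k j \<longrightarrow> w \<notin> U k j}"
  proof (rule Kuratowski_Ulam_rectangles[of Y "\<lambda>k j. f ` B k j" W U "f ` E"])
    show "second_countable Y" using Yf perfect_polish_space_facts by blast
    show "f ` B k j \<in> sets (borel_of Y)" for k j
      using borel_isomorphism_image Yf B by blast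
    show "f ` E \<subseteq> topspace Y" using im E by auto
    show "\<exists>j. t \<in> f ` B k j \<and> U k j \<inter> G \<noteq> {}" if "t \<in> f ` E" "openin W G" "G \<noteq> {}" for t k G
    proof -
      obtain z where z: "z \<in> E" "t = f z" using \<open>t \<in> f ` E\<close> by auto
      show ?thesis using dense[OF z(1) that(2,3), of k] z(2) by blast
    qed
  qed (use U in auto)
  obtain w where w: "w \<in> N" "w \<notin> M"
    using N M(1) meager_in_subset[of W M N] by auto
  have "meager_in Y {t \<in> f ` E. \<exists>k. \<forall>j. t \<in> f ` B k j \<longrightarrow> w \<notin> U k j}"
    using M(2) w N by auto
  moreover have "meager_in Y (f ` {z \<in> E. \<forall>k. \<exists>j. z \<in> B k j \<and> w \<in> U k j})"
    using small[OF w(1)] Yf unfolding universally_meager_def by blast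
  ultimately have "meager_in Y ({t \<in> f ` E. \<exists>k. \<forall>j. t \<in> f ` B k j \<longrightarrow> w \<notin> U k j}
      \<union> f ` {z \<in> E. \<forall>k. \<exists>j. z \<in> B k j \<and> w \<in> U k j})"
    by (rule meager_in_Un)
  moreover have "f ` E \<subseteq> {t \<in> f ` E. \<exists>k. \<forall>j. t \<in> f ` B k j \<longrightarrow> w \<notin> U k j}
      \<union> f ` {z \<in> E. \<forall>k. \<exists>j. z \<in> B k j \<and> w \<in> U k j}"
    using iff by auto
  ultimately show "meager_in Y (f ` E)" by (rule meager_in_subset)
qed

lemma universally_meager_countable:
  assumes "A \<subseteq> topspace X" "countable A"
  shows "universally_meager X A"
  unfolding universally_meager_def
proof (intro conjI allI impI assms)
  fix Y :: "'a topology" and f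
  assume Yf: "perfect_polish_space Y \<and> borel_isomorphism X Y f"
  then have "f ` topspace X = topspace Y" by (auto simp: borel_isomorphism_def bij_betw_def)
  then have "f ` A \<subseteq> topspace Y" using assms by auto
  then show "meager_in Y (f ` A)"
    using Yf perfect_polish_space_facts(4,5)[of Y] assms by (intro meager_in_countable) simp_all
qed

subsection \<open>Pulling back meager sets from the Cantor space\<close>

text \<open>This grows a binary tree of open sets: \<open>W\<close> and
  \<open>U - X closure_of W\<close> become the children of \<open>U\<close>. Entering
  \<open>V\<close> whenever possible makes the tree reach inside every basic set. Separating two
  points of \<open>U\<close> keeps the second child nonempty.\<close>

lemma perfect_open_splitting:
  assumes "Hausdorff_space X" "topspace X \<subseteq> X derived_set_of topspace X"
    and U: "openin X U" "U \<noteq> {}" and V: "openin X V"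
  shows "\<exists>W. openin X W \<and> W \<noteq> {} \<and> W \<subseteq> U \<and> U - X closure_of W \<noteq> {} \<and> (U \<inter> V \<noteq> {} \<longrightarrow> W \<subseteq> V)"
proof -
  define G where "G = (if U \<inter> V \<noteq> {} then U \<inter> V else U)"
  have G: "openin X G" "G \<noteq> {}" "G \<subseteq> U" "U \<inter> V \<noteq> {} \<longrightarrow> G \<subseteq> V"
    unfolding G_def using U V by auto
  obtain a where a: "a \<in> G" using G by auto
  then have "a \<in> X derived_set_of topspace X" using assms(2) openin_subset[OF G(1)] by auto
  then obtain b where b: "b \<noteq> a" "b \<in> G" using G(1) a unfolding in_derived_set_of by blast
  obtain A B where AB: "openin X A" "openin X B" "a \<in> A" "b \<in> B" "A \<inter> B = {}"
  proof -
    have "a \<in> topspace X \<and> b \<in> topspace X \<and> a \<noteq> b" using a b openin_subset[OF G(1)] by auto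
    then show ?thesis using assms(1) that unfolding Hausdorff_space_def disjnt_def by meson
  qed
  have "(A \<inter> G) \<inter> B = {}" using AB by auto
  then have "B \<inter> X closure_of (A \<inter> G) = {}"
    using openin_Int_closure_of_eq_empty[OF AB(2)] by auto
  then have "b \<in> U - X closure_of (A \<inter> G)" using b AB G by auto
  then show ?thesis using AB G a by (intro exI[of _ "A \<inter> G"]) auto
qed

definition split_open :: "'a topology \<Rightarrow> 'a set \<Rightarrow> 'a set \<Rightarrow> 'a set" where
  "split_open X V U = (SOME W. openin X W \<and> W \<noteq> {} \<and> W \<subseteq> U \<and> U - X closure_of W \<noteq> {} \<and>
     (U \<inter> V \<noteq> {} \<longrightarrow> W \<subseteq> V))"

primrec branch :: "'a topology \<Rightarrow> (nat \<Rightarrow> 'a set) \<Rightarrow> (nat \<Rightarrow> bool) \<Rightarrow> nat \<Rightarrow> 'a set" where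
  "branch X V y 0 = topspace X"
| "branch X V y (Suc n) = (let U = branch X V y n; W = split_open X (V n) U in
     if y n then W else U - X closure_of W)"

text \<open>Here the word followed down the tree is read off from \<open>t\<close> itself. The
  recursion carries only the current set, which avoids a mutual recursion with
  \<open>address\<close>.\<close>

primrec address_branch :: "'a topology \<Rightarrow> (nat \<Rightarrow> 'a set) \<Rightarrow> 'a \<Rightarrow> nat \<Rightarrow> 'a set" where
  "address_branch X V t 0 = topspace X"
| "address_branch X V t (Suc n) = (let U = address_branch X V t n; W = split_open X (V n) U in
     if t \<in> W then W else U - X closure_of W)"

definition address :: "'a topology \<Rightarrow> (nat \<Rightarrow> 'a set) \<Rightarrow> 'a \<Rightarrow> nat \<Rightarrow> bool" where
  "address X V t n \<longleftrightarrow> t \<in> split_open X (V n) (address_branch X V t n)"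

lemma branch_cong: "(\<And>i. i < n \<Longrightarrow> y i = y' i) \<Longrightarrow> branch X V y n = branch X V y' n"
  by (induction n) (simp_all add: Let_def)

lemma branch_address: "branch X V (address X V t) n = address_branch X V t n"
  by (induction n) (simp_all add: Let_def address_def)

lemma finite_branches: "finite (range (\<lambda>y. branch X V y n))"
proof (induction n)
  case (Suc n)
  let ?F = "\<lambda>U. split_open X (V n) U"
  have "range (\<lambda>y. branch X V y (Suc n)) \<subseteq>
      (\<lambda>U. ?F U) ` range (\<lambda>y. branch X V y n) \<union> (\<lambda>U. U - X closure_of ?F U) ` range (\<lambda>y. branch X V y n)"
    by (auto simp: Let_def)
  then show ?case using Suc by (meson finite_Un finite_imageI finite_subset)
qed auto

lemma cantor_space_openin_finite:
  assumes "finite I" shows "openin cantor_space {y. \<forall>i\<in>I. y i = x i}"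
proof -
  have "openin cantor_space (\<Pi>\<^sub>E i\<in>UNIV. if i \<in> I then {x i} else UNIV)"
    unfolding cantor_space_def using assms
    by (intro openin_PiE_gen[THEN iffD2]) (auto intro: finite_subset[of _ I])
  moreover have "(\<Pi>\<^sub>E i\<in>UNIV. if i \<in> I then {x i} else UNIV) = {y. \<forall>i\<in>I. y i = x i}"
    by (auto simp: PiE_iff split: if_splits)
  ultimately show ?thesis by simp
qed

lemma cantor_space_openin_cylinder: "openin cantor_space {y. \<forall>i<n. y i = x i}"
  using cantor_space_openin_finite[of "{..<n}" x] by (simp add: Ball_def)

text \<open>The branches form a tree of open sets indexed by finite binary words whose members are a
  \<open>\<pi>\<close>-base, so the (almost everywhere defined) address map pulls nowhere dense sets back to
  nowhere dense sets.\<close>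

lemma cantor_meager_pullback:
  fixes X :: "'a topology"
  assumes X: "Hausdorff_space X" "second_countable X" "topspace X \<subseteq> X derived_set_of topspace X"
  obtains \<phi> :: "'a \<Rightarrow> nat \<Rightarrow> bool"
    where "\<And>M. meager_in cantor_space M \<Longrightarrow> meager_in X {t \<in> topspace X. \<phi> t \<in> M}"
proof (cases "topspace X = {}")
  case True
  then show ?thesis using that meager_in_nowhere_dense[OF nowhere_dense_in_empty, of X] by simp
next
  case False
  obtain V where V: "\<And>n::nat. openin X (V n)"
    "\<And>U x. openin X U \<Longrightarrow> x \<in> U \<Longrightarrow> \<exists>n. x \<in> V n \<and> V n \<subseteq> U"
    using second_countable_sequence[OF X(2)] by blast
  have so: "openin X (split_open X (V n) U)" "split_open X (V n) U \<noteq> {}" "split_open X (V n) U \<subseteq> U"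
    "U - X closure_of (split_open X (V n) U) \<noteq> {}" "U \<inter> V n \<noteq> {} \<Longrightarrow> split_open X (V n) U \<subseteq> V n"
    if "openin X U" "U \<noteq> {}" for U n
    using someI_ex[OF perfect_open_splitting[OF X(1,3) that V(1)]] unfolding split_open_def by blast+
  let ?U = "branch X V"
  have br: "openin X (?U y n) \<and> ?U y n \<noteq> {}" for y n
  proof (induction n)
    case (Suc n)
    then show ?case using so[of "?U y n" n] by (auto simp: Let_def openin_diff)
  qed (use False in simp)
  note so' = so[OF conjunct1[OF br] conjunct2[OF br]]
  have mono: "?U y n \<subseteq> ?U y m" if "m \<le> n" for y m n
    using that
  proof (induction n rule: dec_induct)
    case (step n)
    have "?U y (Suc n) \<subseteq> ?U y n" using so'(3)[of n y n] by (auto simp: Let_def)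
    then show ?case using step by blast
  qed simp
  \<comment> \<open>Each level of the tree has dense union: if \<open>G\<close> meets a node but
    misses its first child, then inside the node it also misses the closure of that child, and so
    meets the second.\<close>
  have meets: "\<exists>y. ?U y n \<inter> G \<noteq> {}" if G: "openin X G" "G \<noteq> {}" for G n
  proof (induction n)
    case 0
    then show ?case using G openin_subset[OF G(1)] by auto
  next
    case (Suc n)
    then obtain y where y: "?U y n \<inter> G \<noteq> {}" by auto
    let ?W = "split_open X (V n) (?U y n)"
    have c: "?U (y(n := b)) n = ?U y n" for b by (rule branch_cong) auto
    show ?case
    proof (cases "?W \<inter> G = {}")
      case True
      then have "(?U y n \<inter> G) \<inter> X closure_of ?W = {}"
        using G by (subst openin_Int_closure_of_eq_empty) (auto simp: br)
      then have "?U (y(n := False)) (Suc n) \<inter> G \<noteq> {}" using y by (auto simp: Let_def c)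
      then show ?thesis by blast
    next
      case False
      then have "?U (y(n := True)) (Suc n) \<inter> G \<noteq> {}" by (auto simp: Let_def c)
      then show ?thesis by blast
    qed
  qed
  have pibase: "\<exists>y n. ?U y n \<subseteq> G" if G: "openin X G" "G \<noteq> {}" for G
  proof -
    obtain n where n: "V n \<noteq> {}" "V n \<subseteq> G" using V(2)[OF G(1)] G(2) by blast
    obtain y where y: "?U y n \<inter> V n \<noteq> {}" using meets[OF V(1) n(1), of n] by auto
    have c: "?U (y(n := True)) n = ?U y n" by (rule branch_cong) auto
    \<comment> \<open>The branch meets \<open>V n\<close>, so the child chosen by
      \<open>True\<close> at \<open>n\<close> lies in \<open>V n\<close>.\<close>
    have "?U (y(n := True)) (Suc n) \<subseteq> G" using so'(5)[OF y] n by (auto simp: Let_def c)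
    then show ?thesis by blast
  qed
  \<comment> \<open>The frontiers at all nodes, finitely many per level. A point outside
    \<open>Bd\<close> never falls between the two children of a node.\<close>
  define Bd where "Bd = (\<Union>n. \<Union>U\<in>range (\<lambda>y. ?U y n). X frontier_of (split_open X (V n) U))"
  have Bd: "meager_in X Bd"
    unfolding Bd_def
    by (intro meager_in_UN countable_finite[OF finite_branches])
       (auto intro!: meager_in_nowhere_dense nowhere_dense_in_frontier_of so'(1))
  have mem: "t \<in> address_branch X V t n" if "t \<in> topspace X - Bd" for t n
  proof (induction n)
    case (Suc n)
    let ?W = "split_open X (V n) (address_branch X V t n)"
    have "openin X ?W" using so'(1)[of n "address X V t" n] by (simp add: branch_address)
    moreover have "t \<notin> X frontier_of ?W"
      using that unfolding Bd_def by (auto simp flip: branch_address)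
    ultimately show ?case using Suc by (auto simp: Let_def frontier_of_openin)
  qed (use that in simp)
  have disj: "t \<notin> ?U y n" if "t \<in> ?U y' n" "i < n" "y i \<noteq> y' i" for t y y' n i
  proof
    assume t: "t \<in> ?U y n"
    define k where "k = (LEAST i. y i \<noteq> y' i)"
    have k: "y k \<noteq> y' k" unfolding k_def using that(3) by (rule LeastI)
    have kn: "k < n" using that(2) Least_le[of "\<lambda>i. y i \<noteq> y' i" i] that(3) unfolding k_def by linarith
    have c: "?U y k = ?U y' k" by (rule branch_cong) (use not_less_Least k_def in blast)
    have "t \<in> ?U y (Suc k)" "t \<in> ?U y' (Suc k)"
      using t that(1) mono[of "Suc k" n] kn by auto
    then show False
      using k c closure_of_subset[OF openin_subset[OF so'(1)[of k y k]]]
      by (auto simp: Let_def split: if_splits)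
  qed
  have nd: "nowhere_dense_in X {t \<in> topspace X - Bd. address X V t \<in> D}"
    if D: "nowhere_dense_in cantor_space D" for D
    unfolding nowhere_dense_in_iff
  proof (intro conjI allI impI)
    fix G assume "openin X G \<and> G \<noteq> {}"
    then obtain y n where yn: "?U y n \<subseteq> G" using pibase by blast
    obtain W where W: "openin cantor_space W" "W \<noteq> {}" "W \<subseteq> {z. \<forall>i<n. z i = y i}" "W \<inter> D = {}"
      by (rule nowhere_dense_inE[OF D cantor_space_openin_cylinder[of n y]]) auto
    then obtain y' where y': "y' \<in> W" by auto
    obtain k where k: "\<And>z. (\<And>i. i < k \<Longrightarrow> z i = y' i) \<Longrightarrow> z \<in> W"
      using cantor_space_nbhd[OF W(1) y'] by blast
    let ?m = "max n k"
    have "?U y' ?m \<subseteq> ?U y' n" by (rule mono) simp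
    also have "?U y' n = ?U y n" by (rule branch_cong) (use y' W in auto)
    finally have "?U y' ?m \<subseteq> G" using yn by auto
    \<comment> \<open>Inside this node addresses agree with \<open>y'\<close> long enough to lie in
      \<open>W\<close>, which misses \<open>D\<close>.\<close>
    moreover have "address X V t \<notin> D" if "t \<in> ?U y' ?m" "t \<in> topspace X - Bd" for t
    proof -
      have "t \<in> ?U (address X V t) ?m" using mem[OF that(2)] by (simp add: branch_address)
      then have "address X V t i = y' i" if "i < ?m" for i
        using disj[OF \<open>t \<in> ?U y' ?m\<close> that] by blast
      then have "address X V t \<in> W" by (intro k) auto
      then show ?thesis using W by auto
    qed
    ultimately show "\<exists>W. openin X W \<and> W \<noteq> {} \<and> W \<subseteq> G \<and>
        W \<inter> {t \<in> topspace X - Bd. address X V t \<in> D} = {}"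
      using br by (intro exI[of _ "?U y' ?m"]) auto
  qed auto
  show ?thesis
  proof (rule that[of "address X V"])
    fix M assume M: "meager_in cantor_space M"
    obtain L where L: "\<And>i::nat. nowhere_dense_in cantor_space (L i)" "M = (\<Union>i. L i)"
      using meager_in_sequence[OF M] by blast
    have "meager_in X {t \<in> topspace X - Bd. address X V t \<in> L i}" for i
      by (rule meager_in_nowhere_dense[OF nd[OF L(1)]])
    then have "meager_in X (\<Union>i. {t \<in> topspace X - Bd. address X V t \<in> L i})"
      by (rule meager_in_UN[OF countableI_type])
    with Bd have "meager_in X (Bd \<union> (\<Union>i. {t \<in> topspace X - Bd. address X V t \<in> L i}))"
      by (rule meager_in_Un)
    then show "meager_in X {t \<in> topspace X. address X V t \<in> M}"
      by (rule meager_in_subset) (auto simp: L(2))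
  qed
qed

text \<open>The map from \<open>cantor_meager_pullback\<close> sends the image of \<open>A\<close>
  in \<open>Y\<close> to a subset of the Cantor space smaller than the continuum, hence meager; its
  preimage in \<open>Y\<close> is meager and covers the image of \<open>A\<close>.\<close>

lemma universally_meager_small:
  assumes small: "\<And>A :: (nat \<Rightarrow> bool) set. |A| <o |UNIV :: (nat \<Rightarrow> bool) set| \<Longrightarrow> meager_in cantor_space A"
    and A: "A \<subseteq> topspace X" "|A| <o |UNIV :: (nat \<Rightarrow> bool) set|"
  shows "universally_meager X A"
  unfolding universally_meager_def
proof (intro conjI allI impI A(1))
  fix Y :: "'a topology" and f
  assume Yf: "perfect_polish_space Y \<and> borel_isomorphism X Y f"
  then have "f ` topspace X = topspace Y" by (auto simp: borel_isomorphism_def bij_betw_def)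
  then have sub: "f ` A \<subseteq> topspace Y" using A by auto
  obtain \<phi> :: "'a \<Rightarrow> nat \<Rightarrow> bool"
    where \<phi>: "\<And>M. meager_in cantor_space M \<Longrightarrow> meager_in Y {t \<in> topspace Y. \<phi> t \<in> M}"
    using cantor_meager_pullback[of Y] perfect_polish_space_facts[of Y] Yf by blast
  have "|(\<phi> \<circ> f) ` A| <o |UNIV :: (nat \<Rightarrow> bool) set|"
    using card_of_image A(2) by (rule ordLeq_ordLess_trans)
  then have "meager_in Y {t \<in> topspace Y. \<phi> t \<in> (\<phi> \<circ> f) ` A}" by (intro \<phi> small)
  then show "meager_in Y (f ` A)"
    by (rule meager_in_subset) (use sub in auto)
qed

subsection \<open>Coding meager sets by points of the Cantor space\<close>

definition pair_code :: "(nat \<Rightarrow> bool) \<Rightarrow> nat set \<Rightarrow> nat \<Rightarrow> bool" where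
  "pair_code x S i = (if even i then x (i div 2) else i div 2 \<in> S)"

definition fst_code :: "(nat \<Rightarrow> bool) \<Rightarrow> nat \<Rightarrow> bool" where
  "fst_code z i = z (2 * i)"

definition snd_code :: "(nat \<Rightarrow> bool) \<Rightarrow> nat set" where
  "snd_code z = {i. z (2 * i + 1)}"

lemma code_simps [simp]:
  "fst_code (pair_code x S) = x" "snd_code (pair_code x S) = S"
  "pair_code (fst_code z) (snd_code z) = z"
  by (auto simp: pair_code_def fst_code_def snd_code_def fun_eq_iff)

text \<open>For infinite \<open>S\<close> the set of all \<open>w\<close> with \<open>separated x S w\<close> is meager, every meager set is
  contained in one of this form, and shrinking \<open>S\<close> only enlarges it.\<close>

definition separated :: "(nat \<Rightarrow> bool) \<Rightarrow> nat set \<Rightarrow> (nat \<Rightarrow> bool) \<Rightarrow> bool" where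
  "separated x S w \<longleftrightarrow> (\<exists>k. \<forall>m\<in>S. \<forall>n\<in>S. k \<le> m \<and> m < n \<longrightarrow> (\<exists>i\<in>{m..<n}. w i \<noteq> x i))"

lemma separated_subset: "separated x S w \<Longrightarrow> T \<subseteq> S \<Longrightarrow> separated x T w"
  unfolding separated_def by (meson subsetD)

lemma openin_imp_borel_of: "openin X U \<Longrightarrow> U \<in> sets (borel_of X)"
  unfolding borel_of_def by (subst sets_measure_of) (auto dest: openin_subset)

lemma borel_of_cantor_coordinate: "{z. z i} \<in> sets (borel_of cantor_space)"
  using cantor_space_openin_finite[of "{i}" "\<lambda>_. True"] by (intro openin_imp_borel_of) simp

text \<open>Grzegorek's argument for codes \<open>z\<close> with reference point \<open>v z\<close>,
  later \<open>fst_code z\<close> in one case and constantly \<open>False\<close> in the other. The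
  rectangles describe how \<open>w\<close> can agree with \<open>v z\<close> between two elements of
  \<open>snd_code z\<close>.\<close>

lemma universally_meager_separated:
  fixes E :: "(nat \<Rightarrow> bool) set"
  assumes v: "\<And>i. {z. v z i} \<in> sets (borel_of cantor_space)"
    and inf: "\<And>z. z \<in> E \<Longrightarrow> infinite (snd_code z)"
    and N: "\<not> meager_in cantor_space N"
    and small: "\<And>w. w \<in> N \<Longrightarrow> universally_meager cantor_space {z \<in> E. \<not> separated (v z) (snd_code z) w}"
  shows "universally_meager cantor_space E"
proof -
  \<comment> \<open>The word \<open>\<sigma>\<close> gives the values on \<open>{m..<n}\<close> at
    their own positions; entries below \<open>m\<close> are ignored. Finite words keep the index
    type countable.\<close>
  define B where "B k = (\<lambda>(m, n, \<sigma> :: bool list). {z. k \<le> m \<and> m < n \<and> m \<in> snd_code z \<and> n \<in> snd_code z \<and>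
      (\<forall>i\<in>{m..<n}. v z i = \<sigma> ! i)})" for k :: nat
  define U where "U k = (\<lambda>(m, n, \<sigma> :: bool list). {w :: nat \<Rightarrow> bool. \<forall>i\<in>{m..<n}. w i = \<sigma> ! i})" for k :: nat
  have iff: "(\<forall>k. \<exists>j. z \<in> B k j \<and> w \<in> U k j) \<longleftrightarrow> \<not> separated (v z) (snd_code z) w" for z w
  proof
    assume *: "\<forall>k. \<exists>j. z \<in> B k j \<and> w \<in> U k j"
    show "\<not> separated (v z) (snd_code z) w"
    proof
      assume "separated (v z) (snd_code z) w"
      then obtain k where k: "\<forall>m\<in>snd_code z. \<forall>n\<in>snd_code z. k \<le> m \<and> m < n \<longrightarrow> (\<exists>i\<in>{m..<n}. w i \<noteq> v z i)"
        unfolding separated_def by blast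
      obtain m n \<sigma> where "z \<in> B k (m, n, \<sigma>)" "w \<in> U k (m, n, \<sigma>)" using * by (metis prod_cases3)
      then show False using k unfolding B_def U_def by fastforce
    qed
  next
    assume ns: "\<not> separated (v z) (snd_code z) w"
    show "\<forall>k. \<exists>j. z \<in> B k j \<and> w \<in> U k j"
    proof
      fix k
      obtain m n where mn: "m \<in> snd_code z" "n \<in> snd_code z" "k \<le> m" "m < n" "\<forall>i\<in>{m..<n}. w i = v z i"
        using ns unfolding separated_def by blast
      then have "z \<in> B k (m, n, map w [0..<n]) \<and> w \<in> U k (m, n, map w [0..<n])"
        unfolding B_def U_def by auto
      then show "\<exists>j. z \<in> B k j \<and> w \<in> U k j" by blast
    qed
  qed
  show ?thesis
  proof (rule universally_meager_Grzegorek[where B = B and U = U and W = cantor_space and N = N])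
    show "B k j \<in> sets (borel_of cantor_space)" for k j
    proof -
      obtain m n \<sigma> where j: "j = (m, n, \<sigma>)" by (metis prod_cases3)
      have [measurable]: "Measurable.pred (borel_of cantor_space) (\<lambda>z. v z i)"
          "Measurable.pred (borel_of cantor_space) (\<lambda>z. i \<in> snd_code z)" for i
        using v[of i] borel_of_cantor_coordinate[of "2 * i + 1"]
        by (auto simp: pred_def space_borel_of snd_code_def)
      have "Measurable.pred (borel_of cantor_space) (\<lambda>z. k \<le> m \<and> m < n \<and> m \<in> snd_code z \<and> n \<in> snd_code z \<and>
          (\<forall>i\<in>{m..<n}. v z i = \<sigma> ! i))"
        by measurable
      then show ?thesis by (simp add: pred_def space_borel_of B_def j)
    qed
    show "openin cantor_space (U k j)" for k j
      unfolding U_def by (auto simp: case_prod_beta intro!: cantor_space_openin_finite)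
    show "\<exists>j. z \<in> B k j \<and> U k j \<inter> G \<noteq> {}"
      if zG: "z \<in> E" "openin cantor_space G" "G \<noteq> {}" for z k G
    proof -
      obtain w where w: "w \<in> G" using zG by auto
      obtain l where l: "\<And>y. (\<And>i. i < l \<Longrightarrow> y i = w i) \<Longrightarrow> y \<in> G"
        using cantor_space_nbhd[OF zG(2) w] by blast
      obtain m where m: "m \<in> snd_code z" "m \<ge> max k l"
        using inf[OF zG(1)] unfolding infinite_nat_iff_unbounded_le by blast
      obtain n where n: "n \<in> snd_code z" "n > m"
        using inf[OF zG(1)] unfolding infinite_nat_iff_unbounded by blast
      \<comment> \<open>Following \<open>w\<close> below \<open>m \<ge> l\<close> stays in
        \<open>G\<close>; copying \<open>v z\<close> from \<open>m\<close> on gives agreement on the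
        block.\<close>
      let ?w = "\<lambda>i. if i < m then w i else v z i"
      have "?w \<in> G" using m by (intro l) auto
      moreover have "z \<in> B k (m, n, map ?w [0..<n]) \<and> ?w \<in> U k (m, n, map ?w [0..<n])"
        using m n unfolding B_def U_def by auto
      ultimately show ?thesis by blast
    qed
    show "universally_meager cantor_space {z \<in> E. \<forall>k. \<exists>j. z \<in> B k j \<and> w \<in> U k j}" if "w \<in> N" for w
      using small[OF that] by (simp only: iff)
  qed (use N in simp_all)
qed

section \<open>Genericity arguments in the Cantor space\<close>

text \<open>Every cylinder shrinks to one inside \<open>X k\<close>, so each \<open>X k\<close>
  contains a dense open set.\<close>

lemma cantor_meager_unboundedI:
  assumes "\<And>k w n. \<exists>w' n'. (\<forall>i<n. w' i = w i) \<and> (\<forall>v. (\<forall>i<n'. v i = w' i) \<longrightarrow> v \<in> X k)"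
  shows "meager_in cantor_space {w. \<exists>k::nat. w \<notin> X k}"
proof -
  have "nowhere_dense_in cantor_space (- X k)" for k
    unfolding nowhere_dense_in_iff
  proof (intro conjI allI impI)
    fix V assume V: "openin cantor_space V \<and> V \<noteq> {}"
    then obtain w where w: "w \<in> V" by auto
    obtain n where n: "\<And>y. (\<And>i. i < n \<Longrightarrow> y i = w i) \<Longrightarrow> y \<in> V"
      using cantor_space_nbhd[of V w] V w by blast
    obtain w' n' where w': "\<forall>i<n. w' i = w i" "\<forall>v. (\<forall>i<n'. v i = w' i) \<longrightarrow> v \<in> X k"
      using assms by metis
    have "{y. \<forall>i<max n n'. y i = w' i} \<subseteq> V" using n w'(1) by auto
    then show "\<exists>W. openin cantor_space W \<and> W \<noteq> {} \<and> W \<subseteq> V \<and> W \<inter> - X k = {}"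
      using w'(2) cantor_space_openin_cylinder[of "max n n'" w']
      by (intro exI[of _ "{y. \<forall>i<max n n'. y i = w' i}"]) auto
  qed simp
  then have "meager_in cantor_space (\<Union>k. - X k)"
    by (intro meager_in_UN[OF countableI_type] meager_in_nowhere_dense)
  moreover have "(\<Union>k. - X k) = {w. \<exists>k. w \<notin> X k}" by auto
  ultimately show ?thesis by simp
qed

lemma infinite_sparse_subset:
  fixes h :: "nat \<Rightarrow> nat"
  assumes "infinite T"
  obtains S where "S \<subseteq> T" "infinite S" "\<And>m n. m \<in> S \<Longrightarrow> n \<in> S \<Longrightarrow> m < n \<Longrightarrow> h m \<le> n"
proof -
  have "\<exists>a. \<forall>j. a j \<in> T \<and> a j < a (Suc j) \<and> h (a j) \<le> a (Suc j)"
  proof (rule dependent_nat_choice)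
    show "\<exists>x. x \<in> T" using assms by (metis ex_in_conv finite.emptyI)
    show "\<exists>y. y \<in> T \<and> x < y \<and> h x \<le> y" for x
      using assms unfolding infinite_nat_iff_unbounded
      by (metis less_imp_le max.strict_boundedE)
  qed
  then obtain a where a: "\<And>j. a j \<in> T" "\<And>j. a j < a (Suc j)" "\<And>j. h (a j) \<le> a (Suc j)" by blast
  have sm: "strict_mono a" using a(2) by (simp add: strict_mono_Suc_iff)
  show ?thesis
  proof
    show "range a \<subseteq> T" using a by auto
    show "infinite (range a)" using sm by (simp add: range_inj_infinite strict_mono_imp_inj_on)
    fix m n assume "m \<in> range a" "n \<in> range a" "m < n"
    then obtain j l where jl: "m = a j" "n = a l" "j < l" using sm strict_mono_less by blast
    then have "a (Suc j) \<le> a l" using sm by (simp add: strict_mono_less_eq)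
    then show "h m \<le> n" using a(3)[of j] jl by simp
  qed
qed

text \<open>The finitely many stems \<open>s\<close> are treated in turn by one block starting at
  \<open>m\<close>. The block is only ever lengthened, so earlier stems stay handled.\<close>

lemma nowhere_dense_avoid:
  assumes D: "nowhere_dense_in cantor_space D" and "finite \<Sigma>"
  shows "\<exists>x' n. m \<le> n \<and> (\<forall>i<m. x' i = x i) \<and>
    (\<forall>s\<in>\<Sigma>. \<forall>y\<in>D. (\<forall>i<m. y i = s i) \<longrightarrow> (\<exists>i\<in>{m..<n}. y i \<noteq> x' i))"
  using assms(2)
proof (induction \<Sigma> rule: finite_induct)
  case (insert s \<Sigma>)
  then obtain x' n where x': "m \<le> n" "\<forall>i<m. x' i = x i"
    "\<And>s y. s \<in> \<Sigma> \<Longrightarrow> y \<in> D \<Longrightarrow> \<forall>i<m. y i = s i \<Longrightarrow> \<exists>i\<in>{m..<n}. y i \<noteq> x' i"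
    by auto
  \<comment> \<open>The new stem followed by the block built so far. An open set below it that
    misses \<open>D\<close> provides the extension of the block.\<close>
  define q where "q = (\<lambda>i. if i < m then s i else x' i)"
  have ne: "{y. \<forall>i<n. y i = q i} \<noteq> {}" by auto
  obtain W where W: "openin cantor_space W" "W \<noteq> {}" "W \<subseteq> {y. \<forall>i<n. y i = q i}" "W \<inter> D = {}"
    by (rule nowhere_dense_inE[OF D cantor_space_openin_cylinder ne])
  then obtain p where p: "p \<in> W" by auto
  obtain k where k: "\<And>y. (\<And>i. i < k \<Longrightarrow> y i = p i) \<Longrightarrow> y \<in> W"
    using cantor_space_nbhd[OF W(1) p] by blast
  have pn: "p i = (if i < m then s i else x' i)" if "i < n" for i using p W(3) that by (auto simp: q_def)
  let ?x = "\<lambda>i. if i < m then x i else p i"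
  have "\<exists>i\<in>{m..<max n k}. y i \<noteq> ?x i" if y: "t \<in> insert s \<Sigma>" "y \<in> D" "\<forall>i<m. y i = t i" for t y
  proof (cases "t \<in> \<Sigma>")
    case True
    then obtain i where i: "i \<in> {m..<n}" "y i \<noteq> x' i" using x'(3) y by blast
    then have "y i \<noteq> ?x i" using pn[of i] by auto
    then show ?thesis using i by (intro bexI[of _ i]) auto
  next
    case False
    then have t: "t = s" using y by simp
    show ?thesis
    proof (rule ccontr)
      assume c: "\<not> ?thesis"
      have "y i = p i" if "i < k" for i
      proof (cases "i < m")
        case True
        then show ?thesis using pn[of i] x'(1) y(3) t by auto
      next
        case False
        then show ?thesis using c that by auto
      qed
      then have "y \<in> W" by (rule k)
      then show False using W(4) y by auto
    qed
  qed
  then show ?case using x'(1) by (intro exI[of _ ?x] exI[of _ "max n k"]) auto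
qed auto

text \<open>A generic \<open>x\<close> has, beyond every \<open>k\<close>, a block with which no member of \<open>D m\<close> agrees,
  whatever the values of that member below the start \<open>m\<close> of the block.\<close>

lemma comeager_separated:
  assumes L: "meager_in cantor_space L"
  shows "meager_in cantor_space {x. \<not> (\<exists>S. infinite S \<and> (\<forall>y\<in>L. separated x S y))}"
proof -
  obtain K where K: "\<And>i::nat. nowhere_dense_in cantor_space (K i)" "L = (\<Union>i. K i)"
    using meager_in_sequence[OF L] by blast
  \<comment> \<open>Taking the first \<open>m + 1\<close> pieces together puts a point of
    \<open>K k\<close> into \<open>D m\<close> for all \<open>m \<ge> k\<close>.\<close>
  define D where "D m = (\<Union>i\<in>{..m}. K i)" for m
  have D: "nowhere_dense_in cantor_space (D m)" for m
    unfolding D_def by (rule nowhere_dense_in_finite_UN) (use K in auto)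
  define Q where "Q m n x \<longleftrightarrow> (\<forall>y\<in>D m. \<exists>i\<in>{m..<n}. y i \<noteq> x i)" for m n and x :: "nat \<Rightarrow> bool"
  define X where "X k = {x. \<exists>m\<ge>k. \<exists>n. Q m n x}" for k
  have mX: "meager_in cantor_space {x. \<exists>k. x \<notin> X k}"
  proof (rule cantor_meager_unboundedI)
    fix k w and n :: nat
    define m where "m = max k n"
    \<comment> \<open>All initial segments of length \<open>m\<close>, continued by
      \<open>False\<close>.\<close>
    define \<Sigma> where "\<Sigma> = (\<lambda>A i. i \<in> A) ` Pow {..<m}"
    have "finite \<Sigma>" unfolding \<Sigma>_def by simp
    from nowhere_dense_avoid[OF D[of m] this, of m w] obtain w' n' where w': "\<forall>i<m. w' i = w i"
      "\<forall>s\<in>\<Sigma>. \<forall>y\<in>D m. (\<forall>i<m. y i = s i) \<longrightarrow> (\<exists>i\<in>{m..<n'}. y i \<noteq> w' i)"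
      by (elim exE conjE) (rule that)
    have "v \<in> X k" if v: "\<forall>i<n'. v i = w' i" for v
    proof -
      have "\<exists>i\<in>{m..<n'}. y i \<noteq> v i" if y: "y \<in> D m" for y
      proof -
        have "(\<lambda>i. i \<in> {i. i < m \<and> y i}) \<in> \<Sigma>" unfolding \<Sigma>_def by (rule imageI) auto
        then obtain i where "i \<in> {m..<n'}" "y i \<noteq> w' i" using w'(2) y by fastforce
        then show ?thesis using v by (intro bexI[of _ i]) auto
      qed
      then have "Q m n' v" unfolding Q_def by blast
      moreover have "k \<le> m" by (simp add: m_def)
      ultimately show ?thesis unfolding X_def by blast
    qed
    then show "\<exists>w' n'. (\<forall>i<n. w' i = w i) \<and> (\<forall>v. (\<forall>i<n'. v i = w' i) \<longrightarrow> v \<in> X k)"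
      using w'(1) by (intro exI[of _ w'] exI[of _ n']) (auto simp: m_def)
  qed
  have "\<exists>S. infinite S \<and> (\<forall>y\<in>L. separated x S y)" if x: "\<forall>k. x \<in> X k" for x
  proof -
    define T where "T = {m. \<exists>n. Q m n x}"
    have T: "infinite T" using x unfolding infinite_nat_iff_unbounded_le T_def X_def by blast
    define h where "h m = (SOME n. Q m n x)" for m
    have h: "Q m (h m) x" if "m \<in> T" for m
      using that someI_ex[of "\<lambda>n. Q m n x"] unfolding T_def h_def by simp
    \<comment> \<open>Sparseness makes every interval between elements of \<open>S\<close> contain
      the full block \<open>{m..<h m}\<close> at its left end.\<close>
    obtain S where S: "S \<subseteq> T" "infinite S" "\<And>m n. m \<in> S \<Longrightarrow> n \<in> S \<Longrightarrow> m < n \<Longrightarrow> h m \<le> n"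
      using infinite_sparse_subset[OF T, of h] by blast
    have "separated x S y" if "y \<in> L" for y
    proof -
      obtain k where k: "y \<in> K k" using \<open>y \<in> L\<close> K(2) by auto
      have "\<exists>i\<in>{m..<n}. y i \<noteq> x i" if mn: "m \<in> S" "n \<in> S" "k \<le> m" "m < n" for m n
      proof -
        have "y \<in> D m" using k mn(3) unfolding D_def by auto
        then obtain i where "i \<in> {m..<h m}" "y i \<noteq> x i" using h[of m] S(1) mn(1) unfolding Q_def by blast
        then show ?thesis using S(3)[OF mn(1,2,4)] by (intro bexI[of _ i]) auto
      qed
      then show ?thesis unfolding separated_def by blast
    qed
    then show ?thesis using S(2) by blast
  qed
  then have "{x. \<not> (\<exists>S. infinite S \<and> (\<forall>y\<in>L. separated x S y))} \<subseteq> {x. \<exists>k. x \<notin> X k}" by blast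
  with mX show ?thesis by (rule meager_in_subset)
qed

section \<open>Fibres over finite sets as perfect test sets\<close>

definition code_fibre :: "nat set \<Rightarrow> (nat \<Rightarrow> bool) set" where
  "code_fibre d = {z. snd_code z = d}"

lemma continuous_map_cantor_coordinate:
  "continuous_map cantor_space (discrete_topology UNIV) (\<lambda>z. z i)"
  unfolding cantor_space_def by (rule continuous_map_product_projection) simp

lemma continuous_map_into_cantor:
  "continuous_map X cantor_space f \<longleftrightarrow> (\<forall>i. continuous_map X (discrete_topology UNIV) (\<lambda>x. f x i))"
  unfolding cantor_space_def by (rule continuous_map_componentwise_UNIV)

lemma perfect_in_code_fibre: "perfect_in cantor_space (code_fibre d)"
proof -
  have "openin cantor_space (- code_fibre d)"
  proof (subst openin_subopen, safe)
    fix z assume "z \<notin> code_fibre d"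
    then obtain i where i: "(i \<in> snd_code z) \<noteq> (i \<in> d)" unfolding code_fibre_def by blast
    have "{y. \<forall>j\<in>{2 * i + 1}. y j = z j} \<subseteq> - code_fibre d"
      using i unfolding code_fibre_def snd_code_def by auto
    then show "\<exists>T. openin cantor_space T \<and> z \<in> T \<and> T \<subseteq> - code_fibre d"
      using cantor_space_openin_finite[of "{2 * i + 1}" z] by blast
  qed
  then have "closedin cantor_space (code_fibre d)"
    by (simp add: closedin_def Compl_eq_Diff_UNIV)
  moreover have "z \<in> cantor_space derived_set_of code_fibre d" if z: "z \<in> code_fibre d" for z
    unfolding in_derived_set_of
  proof (intro conjI allI impI)
    fix T assume "z \<in> T \<and> openin cantor_space T"
    then obtain k where k: "\<And>y. (\<And>n. n < k \<Longrightarrow> y n = z n) \<Longrightarrow> y \<in> T"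
      using cantor_space_nbhd by metis
    \<comment> \<open>Flipping coordinate \<open>2 * k\<close> changes neither the first
      \<open>k\<close> coordinates nor the odd ones, so the point stays in \<open>T\<close> and in
      the fibre.\<close>
    have "z(2 * k := \<not> z (2 * k)) \<in> T" by (rule k) auto
    moreover have "z(2 * k := \<not> z (2 * k)) \<in> code_fibre d"
      using z unfolding code_fibre_def snd_code_def by auto presburger+
    moreover have "z(2 * k := \<not> z (2 * k)) \<noteq> z" by (metis fun_upd_same)
    ultimately show "\<exists>y. y \<noteq> z \<and> y \<in> code_fibre d \<and> y \<in> T" by blast
  qed simp
  ultimately show ?thesis unfolding perfect_in_def by blast
qed

lemma meager_in_code_fibreD:
  assumes "meager_in (subtopology cantor_space (code_fibre d)) (F \<inter> code_fibre d)"
  shows "meager_in cantor_space {x. pair_code x d \<in> F}"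
proof -
  have "homeomorphic_maps (subtopology cantor_space (code_fibre d)) cantor_space fst_code (\<lambda>x. pair_code x d)"
    unfolding homeomorphic_maps_def
  proof (intro conjI ballI)
    show "continuous_map (subtopology cantor_space (code_fibre d)) cantor_space fst_code"
      unfolding continuous_map_into_cantor fst_code_def
      by (intro allI continuous_map_from_subtopology continuous_map_cantor_coordinate)
    have "continuous_map cantor_space cantor_space (\<lambda>x. pair_code x d)"
      unfolding continuous_map_into_cantor
    proof
      fix i
      show "continuous_map cantor_space (discrete_topology UNIV) (\<lambda>x. pair_code x d i)"
        by (cases "even i") (simp_all add: pair_code_def continuous_map_cantor_coordinate)
    qed
    then show "continuous_map cantor_space (subtopology cantor_space (code_fibre d)) (\<lambda>x. pair_code x d)"
      by (simp add: continuous_map_in_subtopology code_fibre_def image_subset_iff)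
  next
    fix z assume "z \<in> topspace (subtopology cantor_space (code_fibre d))"
    then have "snd_code z = d" by (simp add: code_fibre_def)
    then show "pair_code (fst_code z) d = z" using code_simps(3)[of z] by simp
  qed simp
  then have "homeomorphic_map (subtopology cantor_space (code_fibre d)) cantor_space fst_code"
    by (rule homeomorphic_maps_imp_map)
  then have "meager_in cantor_space (fst_code ` (F \<inter> code_fibre d))"
    using assms by (rule homeomorphic_map_meager_in)
  moreover have "{x. pair_code x d \<in> F} \<subseteq> fst_code ` (F \<inter> code_fibre d)"
  proof
    fix x assume "x \<in> {x. pair_code x d \<in> F}"
    then have "pair_code x d \<in> F \<inter> code_fibre d" by (simp add: code_fibre_def)
    then show "x \<in> fst_code ` (F \<inter> code_fibre d)" by (metis code_simps(1) imageI)
  qed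
  ultimately show ?thesis by (rule meager_in_subset)
qed

text \<open>The \<open>F\<^sub>\<sigma>\<close> sets that a counterexample must escape.\<close>

definition fibrewise_meager :: "(nat \<Rightarrow> bool) set \<Rightarrow> bool" where
  "fibrewise_meager F \<longleftrightarrow> fsigma_in cantor_space F \<and>
     (\<forall>d. finite d \<longrightarrow> meager_in (subtopology cantor_space (code_fibre d)) (F \<inter> code_fibre d))"

text \<open>\<open>set_decode\<close> enumerates the finite sets and so yields a sequence of perfect
  fibres to test against.\<close>

lemma not_countably_perfectly_meagerI:
  assumes "\<And>F. fibrewise_meager F \<Longrightarrow> \<not> E \<subseteq> F"
  shows "\<not> countably_perfectly_meager cantor_space E"
proof
  assume "countably_perfectly_meager cantor_space E"
  moreover have "\<forall>n. perfect_in cantor_space (code_fibre (set_decode n))"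
    using perfect_in_code_fibre by blast
  ultimately obtain F where F: "fsigma_in cantor_space F" "E \<subseteq> F"
    "\<forall>n. meager_in (subtopology cantor_space (code_fibre (set_decode n))) (F \<inter> code_fibre (set_decode n))"
    unfolding countably_perfectly_meager_def by meson
  have "fibrewise_meager F"
    unfolding fibrewise_meager_def using F(1,3) by (metis set_encode_inverse)
  then show False using assms F(2) by blast
qed

lemma fibrewise_meager_sections:
  assumes "fibrewise_meager F"
  shows "meager_in cantor_space {x. \<exists>d. finite d \<and> pair_code x d \<in> F}"
proof -
  have "meager_in cantor_space {x. pair_code x (set_decode n) \<in> F}" for n
    using assms meager_in_code_fibreD finite_set_decode unfolding fibrewise_meager_def by blast
  then have "meager_in cantor_space (\<Union>n. {x. pair_code x (set_decode n) \<in> F})"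
    by (rule meager_in_UN[OF countableI_type])
  then show ?thesis
    by (rule meager_in_subset) (auto, metis set_encode_inverse)
qed

text \<open>The complement of a section of \<open>F\<close> is a \<open>G\<^sub>\<delta>\<close> set containing all finite sets, so it contains
  every set with sufficiently long gaps.\<close>

lemma fsigma_section_gaps:
  assumes F: "fsigma_in cantor_space F" and x: "\<And>d. finite d \<Longrightarrow> pair_code x d \<notin> F"
  obtains g :: "nat \<Rightarrow> nat" where "\<And>k. k \<le> g k"
    "\<And>S. (\<And>k0. \<exists>k\<ge>k0. S \<inter> {k..<g k} = {}) \<Longrightarrow> pair_code x S \<notin> F"
proof -
  obtain C where C: "\<And>n::nat. closedin cantor_space (C n)" "\<And>n. C n \<subseteq> C (Suc n)" "\<Union>(range C) = F"
    using F unfolding fsigma_in_ascending by blast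
  have mono: "C m \<subseteq> C n" if "m \<le> n" for m n using C(2) lift_Suc_mono_le that by blast
  \<comment> \<open>Only finitely many traces of \<open>S\<close> below \<open>k\<close> occur, so
    one gap end \<open>g\<close> serves all of them.\<close>
  have "\<exists>g. k \<le> g \<and> (\<forall>S. S \<inter> {k..<g} = {} \<longrightarrow> pair_code x S \<notin> C k)" for k
  proof -
    have "\<exists>l. \<forall>S. S \<inter> {..<l} = d \<inter> {..<l} \<longrightarrow> pair_code x S \<notin> C k" if "d \<in> Pow {..<k}" for d
    proof -
      have "finite d" using that finite_subset by auto
      then have 1: "pair_code x d \<in> UNIV - C k" using x[of d] C(3) by auto
      have 2: "openin cantor_space (UNIV - C k)" using C(1)[of k] by (simp add: closedin_def)
      obtain l where l: "\<And>y. (\<And>i. i < l \<Longrightarrow> y i = pair_code x d i) \<Longrightarrow> y \<in> UNIV - C k"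
        using cantor_space_nbhd[OF 2 1] by blast
      have "pair_code x S \<notin> C k" if S: "S \<inter> {..<l} = d \<inter> {..<l}" for S
      proof -
        have "pair_code x S i = pair_code x d i" if "i < l" for i
        proof -
          \<comment> \<open>Coordinate \<open>i\<close> of a code depends on its set only at
            \<open>i div 2\<close>.\<close>
          have "i div 2 < l" using that by linarith
          then have "i div 2 \<in> S \<longleftrightarrow> i div 2 \<in> d" using S by blast
          then show ?thesis by (simp add: pair_code_def)
        qed
        then show ?thesis using l by blast
      qed
      then show ?thesis by blast
    qed
    then obtain l where l: "\<And>d S. d \<in> Pow {..<k} \<Longrightarrow> S \<inter> {..<l d} = d \<inter> {..<l d} \<Longrightarrow> pair_code x S \<notin> C k"
      by metis
    define g where "g = Max (insert k (l ` Pow {..<k}))"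
    have kg: "k \<le> g" unfolding g_def by (intro Max_ge) auto
    have lg: "l d \<le> g" if "d \<in> Pow {..<k}" for d unfolding g_def using that by (intro Max_ge) auto
    have "pair_code x S \<notin> C k" if S: "S \<inter> {k..<g} = {}" for S
    proof (rule l)
      show "S \<inter> {..<k} \<in> Pow {..<k}" by auto
      then have lgS: "l (S \<inter> {..<k}) \<le> g" by (rule lg)
      have "i < k" if "i \<in> S" "i < l (S \<inter> {..<k})" for i
      proof (rule ccontr)
        assume "\<not> i < k"
        then have "i \<in> S \<inter> {k..<g}" using that lgS by auto
        then show False using S by simp
      qed
      then show "S \<inter> {..<l (S \<inter> {..<k})} = S \<inter> {..<k} \<inter> {..<l (S \<inter> {..<k})}" by auto
    qed
    then show ?thesis using kg by blast
  qed
  then obtain g where g: "\<And>k. k \<le> g k" "\<And>k S. S \<inter> {k..<g k} = {} \<Longrightarrow> pair_code x S \<notin> C k" by metis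
  show ?thesis
  proof (rule that[of g, OF g(1)])
    fix S assume S: "\<And>k0. \<exists>k\<ge>k0. S \<inter> {k..<g k} = {}"
    show "pair_code x S \<notin> F"
    proof
      assume "pair_code x S \<in> F"
      then obtain k0 where k0: "pair_code x S \<in> C k0" using C(3) by auto
      \<comment> \<open>As \<open>C\<close> is increasing, a gap at any \<open>k \<ge> k0\<close>
        excludes the point from \<open>C k0\<close>.\<close>
      obtain k where "k \<ge> k0" "S \<inter> {k..<g k} = {}" using S by blast
      then show False using g(2) mono[of k0 k] k0 by blast
    qed
  qed
qed

subsection \<open>The two cases\<close>

text \<open>A closed set is the complement of the union of the basic open sets missing it, so
  \<open>c\<close> can code a sequence of closed sets. This lets the points of the Cantor space
  index the \<open>F\<^sub>\<sigma>\<close> sets.\<close>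

lemma fsigma_in_enumeration:
  assumes "second_countable X"
  obtains \<Phi> :: "(nat \<Rightarrow> bool) \<Rightarrow> 'a set" where "\<And>F. fsigma_in X F \<Longrightarrow> \<exists>c. F = \<Phi> c"
proof -
  obtain V where V: "\<And>n::nat. openin X (V n)"
    "\<And>U x. openin X U \<Longrightarrow> x \<in> U \<Longrightarrow> \<exists>n. x \<in> V n \<and> V n \<subseteq> U"
    using second_countable_sequence[OF assms] by blast
  define \<Phi> where "\<Phi> c = (\<Union>i. topspace X - (\<Union>n\<in>{n. c (prod_encode (i, n))}. V n))" for c
  have "\<exists>c. F = \<Phi> c" if F: "fsigma_in X F" for F
  proof -
    obtain C where C: "\<And>n::nat. closedin X (C n)" "\<Union>(range C) = F"
      using F unfolding fsigma_in_ascending by blast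
    define c where "c j = (case prod_decode j of (i, n) \<Rightarrow> V n \<subseteq> topspace X - C i)" for j
    have "topspace X - (\<Union>n\<in>{n. c (prod_encode (i, n))}. V n) = C i" for i
    proof -
      have 1: "openin X (topspace X - C i)" using C(1) by blast
      have "(\<Union>n\<in>{n. c (prod_encode (i, n))}. V n) = topspace X - C i"
      proof
        show "topspace X - C i \<subseteq> (\<Union>n\<in>{n. c (prod_encode (i, n))}. V n)"
        proof
          fix x assume "x \<in> topspace X - C i"
          then obtain n where "x \<in> V n" "V n \<subseteq> topspace X - C i" using V(2)[OF 1] by blast
          then show "x \<in> (\<Union>n\<in>{n. c (prod_encode (i, n))}. V n)" unfolding c_def by auto
        qed
      qed (auto simp: c_def)
      then show ?thesis using closedin_subset[OF C(1)[of i]] by auto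
    qed
    then have "\<Phi> c = F" unfolding \<Phi>_def using C(2) by simp
    then show ?thesis by blast
  qed
  then show ?thesis using that by blast
qed

lemma not_meager_cantor_UNIV: "\<not> meager_in cantor_space UNIV"
  using not_meager_in_topspace[of cantor_space] perfect_polish_space_facts(1)[OF perfect_polish_cantor_space]
  by simp

lemma meager_in_cantor_countable: "countable A \<Longrightarrow> meager_in cantor_space A"
  using perfect_polish_space_facts(4,5)[OF perfect_polish_cantor_space]
  by (intro meager_in_countable) simp_all

text \<open>First \<open>x\<close> is chosen outside two meager sets, then an infinite
  \<open>S\<close> for it is thinned out until its gaps keep the code out of \<open>F\<close>;
  thinning preserves \<open>separated\<close>.\<close>

lemma separated_code_avoiding:
  assumes L: "meager_in cantor_space L"
  obtains z where "infinite (snd_code z)" "\<And>y. y \<in> L \<Longrightarrow> separated (fst_code z) (snd_code z) y"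
    "fibrewise_meager F \<Longrightarrow> z \<notin> F"
proof -
  define H where "H = (if fibrewise_meager F then {x. \<exists>d. finite d \<and> pair_code x d \<in> F} else {})"
  have "meager_in cantor_space H"
    unfolding H_def using fibrewise_meager_sections meager_in_cantor_countable[of "{}"] by simp
  then have "meager_in cantor_space ({x. \<not> (\<exists>S. infinite S \<and> (\<forall>y\<in>L. separated x S y))} \<union> H)"
    using comeager_separated[OF L] by (rule meager_in_Un[rotated])
  then have "{x. \<not> (\<exists>S. infinite S \<and> (\<forall>y\<in>L. separated x S y))} \<union> H \<noteq> UNIV"
    using not_meager_cantor_UNIV by (rule_tac notI) simp
  then obtain x where "x \<notin> {x. \<not> (\<exists>S. infinite S \<and> (\<forall>y\<in>L. separated x S y))} \<union> H" by blast
  then obtain S where S: "infinite S" "\<forall>y\<in>L. separated x S y" and xH: "x \<notin> H" by blast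
  show ?thesis
  proof (cases "fibrewise_meager F")
    case False
    then show ?thesis using S by (intro that[of "pair_code x S"]) auto
  next
    case True
    then obtain g :: "nat \<Rightarrow> nat" where g: "\<And>k. k \<le> g k"
      "\<And>S. (\<And>k0. \<exists>k\<ge>k0. S \<inter> {k..<g k} = {}) \<Longrightarrow> pair_code x S \<notin> F"
      using fsigma_section_gaps[of F x] xH unfolding H_def fibrewise_meager_def by auto
    \<comment> \<open>The gap after \<open>m\<close> starts at \<open>Suc m\<close>, hence
      \<open>g (Suc m)\<close>.\<close>
    obtain T where T: "T \<subseteq> S" "infinite T" "\<And>m n. m \<in> T \<Longrightarrow> n \<in> T \<Longrightarrow> m < n \<Longrightarrow> g (Suc m) \<le> n"
      using infinite_sparse_subset[OF S(1), of "\<lambda>m. g (Suc m)"] by blast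
    have "\<exists>k\<ge>k0. T \<inter> {k..<g k} = {}" for k0
    proof -
      obtain m where m: "m \<in> T" "m \<ge> k0" using T(2) unfolding infinite_nat_iff_unbounded_le by blast
      have "n \<notin> T" if "n \<in> {Suc m..<g (Suc m)}" for n
        using T(3)[OF m(1), of n] that by auto
      then have "T \<inter> {Suc m..<g (Suc m)} = {}" by blast
      then show ?thesis using m(2) by (intro exI[of _ "Suc m"]) simp
    qed
    then have "pair_code x T \<notin> F" by (rule g(2))
    then show ?thesis using S(2) T(1,2) separated_subset by (intro that[of "pair_code x T"]) auto
  qed
qed

lemma small_meager_case:
  assumes small: "\<And>A :: (nat \<Rightarrow> bool) set. |A| <o |UNIV :: (nat \<Rightarrow> bool) set| \<Longrightarrow> meager_in cantor_space A"
  shows "\<exists>A. universally_meager cantor_space A \<and> \<not> countably_perfectly_meager cantor_space A"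
proof -
  \<comment> \<open>A point \<open>\<xi>\<close> serves both as a stage of the construction and,
    through \<open>\<Phi>\<close>, as the code of the set escaped at that stage.\<close>
  define r where "r = |UNIV :: (nat \<Rightarrow> bool) set|"
  have co: "Card_order r" and Fr: "Field r = UNIV" unfolding r_def by (rule card_of_Card_order, rule Field_card_of)
  have wo: "wo_rel r" using co by (simp add: card_order_on_def wo_rel_def)
  obtain \<Phi> :: "(nat \<Rightarrow> bool) \<Rightarrow> (nat \<Rightarrow> bool) set" where \<Phi>: "\<And>F. fsigma_in cantor_space F \<Longrightarrow> \<exists>c. F = \<Phi> c"
    using fsigma_in_enumeration[OF perfect_polish_space_facts(2)[OF perfect_polish_cantor_space]] by blast
  have under: "meager_in cantor_space (insert \<xi> (underS r \<xi>))" for \<xi>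
  proof -
    have "meager_in cantor_space (underS r \<xi>)"
      using card_of_underS[OF co] Fr by (intro small) (simp add: r_def)
    then show ?thesis using meager_in_Un[OF meager_in_cantor_countable[of "{\<xi>}"]] by simp
  qed
  have "\<exists>z. infinite (snd_code z) \<and> (\<forall>y \<in> insert \<xi> (underS r \<xi>). separated (fst_code z) (snd_code z) y) \<and>
      (fibrewise_meager (\<Phi> \<xi>) \<longrightarrow> z \<notin> \<Phi> \<xi>)" for \<xi>
    using separated_code_avoiding[OF under[of \<xi>], of "\<Phi> \<xi>"] by metis
  then obtain z where z: "\<And>\<xi>. infinite (snd_code (z \<xi>))"
    "\<And>\<xi> y. y \<in> insert \<xi> (underS r \<xi>) \<Longrightarrow> separated (fst_code (z \<xi>)) (snd_code (z \<xi>)) y"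
    "\<And>\<xi>. fibrewise_meager (\<Phi> \<xi>) \<Longrightarrow> z \<xi> \<notin> \<Phi> \<xi>" by metis
  have "universally_meager cantor_space (range z)"
  proof (rule universally_meager_separated[where v = fst_code and N = UNIV])
    show "{z. fst_code z i} \<in> sets (borel_of cantor_space)" for i
      unfolding fst_code_def by (rule borel_of_cantor_coordinate)
    show "infinite (snd_code y)" if "y \<in> range z" for y using that z(1) by auto
    show "\<not> meager_in cantor_space UNIV" by (rule not_meager_cantor_UNIV)
    show "universally_meager cantor_space {y \<in> range z. \<not> separated (fst_code y) (snd_code y) w}" for w
    proof (rule universally_meager_small[OF small])
      \<comment> \<open>A code fails at \<open>w\<close> only if it was chosen before stage
        \<open>w\<close>, and there are fewer than continuum many such stages.\<close>
      have "{y \<in> range z. \<not> separated (fst_code y) (snd_code y) w} \<subseteq> z ` underS r w"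
      proof
        fix y assume "y \<in> {y \<in> range z. \<not> separated (fst_code y) (snd_code y) w}"
        then obtain \<xi> where \<xi>: "y = z \<xi>" "\<not> separated (fst_code (z \<xi>)) (snd_code (z \<xi>)) w" by auto
        then have "w \<noteq> \<xi>" "w \<notin> underS r \<xi>" using z(2) by auto
        moreover have "(w, \<xi>) \<in> r \<or> (\<xi>, w) \<in> r" using wo_rel.TOTALS[OF wo] Fr by blast
        ultimately have "\<xi> \<in> underS r w" unfolding underS_def by auto
        then show "y \<in> z ` underS r w" using \<xi> by blast
      qed
      then have "|{y \<in> range z. \<not> separated (fst_code y) (snd_code y) w}| \<le>o |z ` underS r w|"
        by (rule card_of_mono1)
      also have "|z ` underS r w| \<le>o |underS r w|" by (rule card_of_image)
      also have "|underS r w| <o r" using card_of_underS[OF co] Fr by simp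
      finally show "|{y \<in> range z. \<not> separated (fst_code y) (snd_code y) w}| <o |UNIV :: (nat \<Rightarrow> bool) set|"
        by (simp add: r_def)
    qed simp_all
  qed
  moreover have "\<not> countably_perfectly_meager cantor_space (range z)"
  proof (rule not_countably_perfectly_meagerI)
    fix F assume F: "fibrewise_meager F"
    then obtain \<xi> where "F = \<Phi> \<xi>" using \<Phi> unfolding fibrewise_meager_def by blast
    then have "z \<xi> \<notin> F" using z(3) F by blast
    then show "\<not> range z \<subseteq> F" by blast
  qed
  ultimately show ?thesis by blast
qed

section \<open>A nonmeager set of size at most aleph_1\<close>

text \<open>With constant reference point \<open>False\<close>, being separated says that all late
  intervals of \<open>S\<close> meet \<open>{n. w n}\<close>. The bound \<open>h m\<close> makes
  \<open>{m..<h m}\<close> meet the first \<open>m + 1\<close> sets of an enumeration, and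
  \<open>S\<close> is taken sparse for \<open>h\<close>.\<close>

lemma sparse_set_meeting:
  assumes "countable \<W>" and inf: "\<And>w. w \<in> \<W> \<Longrightarrow> infinite {n. w n}"
  obtains S where "infinite S" "\<And>w. w \<in> \<W> \<Longrightarrow> separated (\<lambda>_. False) S w"
proof (cases "\<W> = {}")
  case True
  then show ?thesis using that[of UNIV] by simp
next
  case False
  define e where "e = from_nat_into \<W>"
  have e: "range e = \<W>" unfolding e_def using assms False by (simp add: range_from_nat_into)
  have "\<exists>h. \<forall>j\<le>m. \<exists>i\<in>{m..<h}. e j i" for m
  proof -
    have "\<exists>i\<ge>m. e j i" for j
      using inf[of "e j"] e unfolding infinite_nat_iff_unbounded_le by auto
    then obtain i where i: "\<And>j. i j \<ge> m" "\<And>j. e j (i j)" by metis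
    have "i j < Suc (Max (i ` {..m}))" if "j \<le> m" for j
      using that by (simp add: less_Suc_eq_le)
    then show ?thesis using i by (intro exI[of _ "Suc (Max (i ` {..m}))"]) (auto intro!: bexI[of _ "i _"])
  qed
  then obtain h where h: "\<And>m j. j \<le> m \<Longrightarrow> \<exists>i\<in>{m..<h m}. e j i" by metis
  obtain S where "S \<subseteq> UNIV" and S: "infinite S" "\<And>m n. m \<in> S \<Longrightarrow> n \<in> S \<Longrightarrow> m < n \<Longrightarrow> h m \<le> n"
    by (rule infinite_sparse_subset[OF infinite_UNIV_nat, of h]) blast
  have "separated (\<lambda>_. False) S w" if "w \<in> \<W>" for w
  proof -
    obtain j where j: "w = e j" using \<open>w \<in> \<W>\<close> e by auto
    have "\<exists>i\<in>{m..<n}. w i \<noteq> False" if mn: "m \<in> S" "n \<in> S" "j \<le> m" "m < n" for m n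
    proof -
      obtain i where "i \<in> {m..<h m}" "e j i" using h[OF mn(3)] by blast
      then show ?thesis using S(2)[OF mn(1,2,4)] j by (intro bexI[of _ i]) auto
    qed
    then show ?thesis unfolding separated_def by blast
  qed
  then show ?thesis using that S(1) by blast
qed

text \<open>Any finite word can be continued by a long enough run of \<open>False\<close>.\<close>

lemma comeager_infinitely_many_gaps:
  fixes g :: "nat \<Rightarrow> nat"
  shows "meager_in cantor_space {w. \<exists>k0. w \<notin> {w. \<exists>k\<ge>k0. \<forall>i\<in>{k..<g k}. \<not> w i}}"
proof (rule cantor_meager_unboundedI)
  fix k w and n :: nat
  let ?w = "\<lambda>i. i < n \<and> w i"
  have "v \<in> {w. \<exists>m\<ge>k. \<forall>i\<in>{m..<g m}. \<not> w i}" if "\<forall>i<g (max k n). v i = ?w i" for v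
    using that by (auto intro!: exI[of _ "max k n"])
  then show "\<exists>w' n'. (\<forall>i<n. w' i = w i) \<and> (\<forall>v. (\<forall>i<n'. v i = w' i) \<longrightarrow> v \<in> {w. \<exists>m\<ge>k. \<forall>i\<in>{m..<g m}. \<not> w i})"
    by (intro exI[of _ ?w] exI[of _ "g (max k n)"]) auto
qed

lemma countable_finite_support: "countable {w :: nat \<Rightarrow> bool. finite {n. w n}}"
proof -
  have "{w :: nat \<Rightarrow> bool. finite {n. w n}} \<subseteq> (\<lambda>A n. n \<in> A) ` {A. finite A}"
    by (auto intro!: image_eqI)
  then show ?thesis
    by (rule countable_subset) (intro countable_image countable_Collect_finite)
qed

text \<open>If \<open>w\<close> vanishes on \<open>{k..<g (g k)}\<close> for a late
  \<open>k\<close>, then \<open>S\<close> cannot meet both \<open>{k..<g k}\<close> and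
  \<open>{g k..<g (g k)}\<close>, since \<open>w\<close> would vanish between two late elements of
  \<open>S\<close>. One of the two is therefore a gap.\<close>

lemma separated_gap:
  assumes sep: "separated (\<lambda>_. False) S w" and g: "\<And>k. k \<le> g k"
    and gaps: "\<And>k0. \<exists>k\<ge>k0. \<forall>i\<in>{k..<g (g k)}. \<not> w i"
  shows "\<exists>k\<ge>k0. S \<inter> {k..<g k} = {}"
proof -
  obtain l where l: "\<forall>m\<in>S. \<forall>n\<in>S. l \<le> m \<and> m < n \<longrightarrow> (\<exists>i\<in>{m..<n}. w i \<noteq> False)"
    using sep unfolding separated_def by blast
  obtain k where k: "k \<ge> max k0 l" "\<forall>i\<in>{k..<g (g k)}. \<not> w i" using gaps by blast
  show ?thesis
  proof (rule ccontr)
    assume c: "\<not> ?thesis"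
    have "S \<inter> {k..<g k} \<noteq> {}" using c k(1) by auto
    then obtain m where m: "m \<in> S" "k \<le> m" "m < g k" by auto
    have "k0 \<le> g k" using k(1) g[of k] by simp
    then have "S \<inter> {g k..<g (g k)} \<noteq> {}" using c by blast
    then obtain n where n: "n \<in> S" "g k \<le> n" "n < g (g k)" by auto
    obtain i where "i \<in> {m..<n}" "w i" using l m n k(1) by force
    then show False using k(2) m n by auto
  qed
qed

lemma nonmeager_aleph1_case:
  fixes A :: "(nat \<Rightarrow> bool) set"
  assumes A: "\<not> meager_in cantor_space A" and cA: "|A| \<le>o cardSuc natLeq"
  shows "\<exists>A. universally_meager cantor_space A \<and> \<not> countably_perfectly_meager cantor_space A"
proof -
  define r where "r = |A|"
  have co: "Card_order r" and Fr: "Field r = A" unfolding r_def by (rule card_of_Card_order, rule Field_card_of)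
  have wo: "wo_rel r" using co by (simp add: card_order_on_def wo_rel_def)
  have total: "(\<beta>, \<gamma>) \<in> r \<or> (\<gamma>, \<beta>) \<in> r" if "\<beta> \<in> A" "\<gamma> \<in> A" for \<beta> \<gamma>
    using wo_rel.TOTALS[OF wo] that Fr by blast
  have trans: "(\<alpha>, \<gamma>) \<in> r" if "(\<alpha>, \<beta>) \<in> r" "(\<beta>, \<gamma>) \<in> r" for \<alpha> \<beta> \<gamma>
    using wo_rel.TRANS[OF wo] that unfolding trans_def by blast
  have field: "\<beta> \<in> A \<and> \<gamma> \<in> A" if "(\<beta>, \<gamma>) \<in> r" for \<beta> \<gamma>
    using that Fr by (metis FieldI1 FieldI2)
  have cnt: "countable (underS r \<gamma>)" for \<gamma>
  proof (cases "\<gamma> \<in> A")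
    case True
    then have "|underS r \<gamma>| <o r" using card_of_underS[OF co] Fr by simp
    then have "|underS r \<gamma>| <o cardSuc natLeq" using cA unfolding r_def by (rule ordLess_ordLeq_trans)
    then have "|underS r \<gamma>| \<le>o natLeq"
      using cardSuc_ordLeq_ordLess[OF natLeq_Card_order card_of_Card_order] by blast
    then show ?thesis by (simp add: countable_card_le_natLeq)
  next
    case False
    then have "underS r \<gamma> = {}" using field unfolding underS_def by auto
    then show ?thesis by simp
  qed
  have cnt': "countable {\<beta>. (\<beta>, \<gamma>) \<in> r}" for \<gamma>
  proof -
    have "{\<beta>. (\<beta>, \<gamma>) \<in> r} \<subseteq> insert \<gamma> (underS r \<gamma>)" unfolding underS_def by auto
    then show ?thesis using cnt by (meson countable_insert countable_subset)
  qed
  have "\<exists>S. infinite S \<and> (\<forall>\<beta>. (\<beta>, \<gamma>) \<in> r \<and> infinite {n. \<beta> n} \<longrightarrow> separated (\<lambda>_. False) S \<beta>)" for \<gamma>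
  proof -
    have "countable {\<beta>. (\<beta>, \<gamma>) \<in> r \<and> infinite {n. \<beta> n}}"
      using cnt'[of \<gamma>] by (rule countable_subset[rotated]) auto
    then obtain S where "infinite S"
      "\<And>\<beta>. \<beta> \<in> {\<beta>. (\<beta>, \<gamma>) \<in> r \<and> infinite {n. \<beta> n}} \<Longrightarrow> separated (\<lambda>_. False) S \<beta>"
      using sparse_set_meeting[of "{\<beta>. (\<beta>, \<gamma>) \<in> r \<and> infinite {n. \<beta> n}}"] by blast
    then show ?thesis by blast
  qed
  then obtain S where S: "\<And>\<gamma>. infinite (S \<gamma>)"
    "\<And>\<beta> \<gamma>. (\<beta>, \<gamma>) \<in> r \<Longrightarrow> infinite {n. \<beta> n} \<Longrightarrow> separated (\<lambda>_. False) (S \<gamma>) \<beta>" by metis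
  \<comment> \<open>Only infinite sets can meet all late intervals. The discarded points are
    countably many, so \<open>N\<close> remains nonmeager.\<close>
  define N where "N = {\<alpha> \<in> A. infinite {n. \<alpha> n}}"
  have N: "\<not> meager_in cantor_space N"
  proof
    assume "meager_in cantor_space N"
    then have "meager_in cantor_space (N \<union> {w. finite {n. w n}})"
      using meager_in_cantor_countable[OF countable_finite_support] by (rule meager_in_Un)
    then have "meager_in cantor_space A" by (rule meager_in_subset) (auto simp: N_def)
    then show False using A by simp
  qed
  define E where "E = (\<lambda>(\<beta>, \<gamma>). pair_code \<beta> (S \<gamma>)) ` r"
  have "universally_meager cantor_space E"
  proof (rule universally_meager_separated[where v = "\<lambda>_ _. False" and N = N])
    show "{z. False} \<in> sets (borel_of cantor_space)" by simp
    show "infinite (snd_code y)" if "y \<in> E" for y using that S(1) unfolding E_def by auto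
    show "universally_meager cantor_space {y \<in> E. \<not> separated (\<lambda>_. False) (snd_code y) w}" if w: "w \<in> N" for w
    proof (rule universally_meager_countable)
      \<comment> \<open>Failure at \<open>w\<close> forces \<open>\<gamma>\<close> strictly before
        \<open>w\<close>, which leaves countably many \<open>\<gamma>\<close> and countably many
        \<open>\<beta>\<close> for each.\<close>
      have "{y \<in> E. \<not> separated (\<lambda>_. False) (snd_code y) w} \<subseteq>
          (\<Union>\<gamma>\<in>underS r w. (\<lambda>\<beta>. pair_code \<beta> (S \<gamma>)) ` {\<beta>. (\<beta>, \<gamma>) \<in> r})"
      proof
        fix y assume "y \<in> {y \<in> E. \<not> separated (\<lambda>_. False) (snd_code y) w}"
        then obtain \<beta> \<gamma> where y: "y = pair_code \<beta> (S \<gamma>)" "(\<beta>, \<gamma>) \<in> r" "\<not> separated (\<lambda>_. False) (S \<gamma>) w"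
          unfolding E_def by auto
        have "(w, \<gamma>) \<notin> r" using S(2)[of w \<gamma>] y(3) w unfolding N_def by auto
        moreover have "w \<in> A" using w unfolding N_def by simp
        ultimately have "\<gamma> \<in> underS r w"
          using total[of w \<gamma>] field[OF y(2)] unfolding underS_def by auto
        then show "y \<in> (\<Union>\<gamma>\<in>underS r w. (\<lambda>\<beta>. pair_code \<beta> (S \<gamma>)) ` {\<beta>. (\<beta>, \<gamma>) \<in> r})"
          using y by blast
      qed
      then show "countable {y \<in> E. \<not> separated (\<lambda>_. False) (snd_code y) w}"
        by (rule countable_subset) (intro countable_UN cnt countable_image cnt')
    qed simp
  qed (rule N)
  moreover have "\<not> countably_perfectly_meager cantor_space E"
  proof (rule not_countably_perfectly_meagerI)
    fix F assume F: "fibrewise_meager F"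
    \<comment> \<open>The order of choices matters: \<open>\<beta>\<close> determines the gap
      function \<open>g\<close>, then \<open>\<alpha>\<close> is taken generic for \<open>g\<close>
      iterated twice, and \<open>\<gamma>\<close> is the larger of the two.\<close>
    have "\<not> A \<subseteq> {x. \<exists>d. finite d \<and> pair_code x d \<in> F}"
      using A fibrewise_meager_sections[OF F] meager_in_subset by blast
    then obtain \<beta> where \<beta>: "\<beta> \<in> A" "\<And>d. finite d \<Longrightarrow> pair_code \<beta> d \<notin> F" by blast
    have fs: "fsigma_in cantor_space F" using F by (simp add: fibrewise_meager_def)
    obtain g :: "nat \<Rightarrow> nat" where g: "\<And>k. k \<le> g k"
      "\<And>S. (\<And>k0. \<exists>k\<ge>k0. S \<inter> {k..<g k} = {}) \<Longrightarrow> pair_code \<beta> S \<notin> F"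
      using fsigma_section_gaps[OF fs \<beta>(2)] by blast
    have "\<not> N \<subseteq> {w. \<exists>k0. w \<notin> {w. \<exists>k\<ge>k0. \<forall>i\<in>{k..<g (g k)}. \<not> w i}}"
      using N meager_in_subset[OF comeager_infinitely_many_gaps[of "\<lambda>k. g (g k)"]] by blast
    then obtain \<alpha> where \<alpha>: "\<alpha> \<in> N" "\<And>k0. \<exists>k\<ge>k0. \<forall>i\<in>{k..<g (g k)}. \<not> \<alpha> i" by blast
    have \<alpha>A: "\<alpha> \<in> A" "infinite {n. \<alpha> n}" using \<alpha>(1) by (simp_all add: N_def)
    obtain \<gamma> where \<gamma>: "(\<beta>, \<gamma>) \<in> r" "(\<alpha>, \<gamma>) \<in> r"
      using total[OF \<beta>(1) \<alpha>A(1)] total[OF \<beta>(1) \<beta>(1)] total[OF \<alpha>A(1) \<alpha>A(1)] by blast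
    have "pair_code \<beta> (S \<gamma>) \<notin> F"
      by (rule g(2), rule separated_gap[OF S(2)[OF \<gamma>(2) \<alpha>A(2)] g(1) \<alpha>(2)])
    moreover have "pair_code \<beta> (S \<gamma>) \<in> E" unfolding E_def using \<gamma>(1) by (force intro: image_eqI)
    ultimately show "\<not> E \<subseteq> F" by blast
  qed
  ultimately show ?thesis by blast
qed

theorem theorem2p2:
  assumes "ctwo ^c natLeq \<le>o aleph_2"
  shows "\<exists>A. universally_meager cantor_space A \<and> \<not> countably_perfectly_meager cantor_space A"
proof (cases "\<forall>A :: (nat \<Rightarrow> bool) set. |A| <o |UNIV :: (nat \<Rightarrow> bool) set| \<longrightarrow> meager_in cantor_space A")
  case True
  then show ?thesis by (intro small_meager_case) blast
next
  case False
  then obtain A :: "(nat \<Rightarrow> bool) set" where A: "|A| <o |UNIV :: (nat \<Rightarrow> bool) set|" "\<not> meager_in cantor_space A"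
    by blast
  have "ctwo ^c natLeq = |UNIV :: (nat \<Rightarrow> bool) set|"
    by (simp add: cexp_def ctwo_def Field_natLeq Field_card_of Func_def)
  \<comment> \<open>The bound on the continuum enters here: a set smaller than the continuum has
    size at most aleph_1.\<close>
  then have "|A| <o cardSuc (cardSuc natLeq)"
    using A(1) assms by (metis ordLess_ordLeq_trans)
  then have "|A| \<le>o cardSuc natLeq"
    using cardSuc_ordLeq_ordLess[OF cardSuc_Card_order[OF natLeq_Card_order] card_of_Card_order] by blast
  then show ?thesis using nonmeager_aleph1_case[OF A(2)] by blast
qed

end
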